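(* Let $p\in(0,2]$ and let $\Gamma$ be a countable group admitting a proper uniformly Lipschitz action on a nonempty subset $A$ of an $L^p$ space. Then $\Gamma$ has a proper uniformly Lipschitz affine action on a subspace of an $L^1$ space; that is, there exist a measure space $(\Omega,\mu)$, a closed subspace $E\subseteq L^1(\Omega,\mu)$, and a proper uniformly Lipschitz affine action of $\Gamma$ on $E$.
   Context: Groups are discrete. For a measure space $(\Omega,\mu)$ and $p\in(0,\infty)$, $L^p(\Omega,\mu)$ is the real vector space of (classes of) measurable functions $f:\Omega\to\mathbb{R}$ with $\lVert f\rVert_p=\left(\int_\Omega|f|^p\,d\mu\right)^{1/p}<\infty$. An $L^p$ space is $L^p(\Omega,\mu)$ for some measure space $(\Omega,\mu)$. For $p\ge 1$ it is a metric space with distance $\lVert f-g\rVert_p$, and for $p\in(0,1)$ it is a metric space with distance $\lVert f-g\rVert_p^p$. Actions on metric spaces. An action of $\Gamma$ on a metric space $(Y,d)$ is uniformly Lipschitz if there is $C\geq 1$ with $d(s\cdot x,s\cdot y)\leq C\,d(x,y)$ for all $s\in\Gamma$, $x,y\in Y$. It is proper if for every $x\in Y$ and every $R>0$ the set $\{s\in\Gamma : d(s\cdot x,x)\leq R\}$ is finite. A subset $A$ of an $L^p$ space carries the restricted metric. Affine actions. An affine action $\sigma$ of $\Gamma$ on a real Banach space $E$ is given by a group homomorphism $\pi:\Gamma\to\operatorname{GL}(E)$ (invertible bounded linear operators) and a map $b:\Gamma\to E$ satisfying $b(st)=\pi(s)b(t)+b(s)$ for all $s,t\in\Gamma$, through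 $\sigma(s)v=\pi(s)v+b(s)$. *)

theory Defs
  imports "HOL-Analysis.Analysis" "HOL-Algebra.Group_Action"
begin

section \<open>The spaces \<open>L\<^sup>p(\<Omega>, \<mu>)\<close> of classes of functions\<close>

text \<open>An element of \<open>L\<^sup>p\<close> is a set of measurable functions, namely a full class of
  almost everywhere equal ones.\<close>

definition ae_class :: "'a measure \<Rightarrow> ('a \<Rightarrow> real) \<Rightarrow> ('a \<Rightarrow> real) set" where
  "ae_class M f = {g \<in> borel_measurable M. AE x in M. g x = f x}"

definition Lp_space :: "'a measure \<Rightarrow> real \<Rightarrow> ('a \<Rightarrow> real) set set" where
  "Lp_space M p =
     ae_class M ` {f \<in> borel_measurable M. integrable M (\<lambda>x. \<bar>f x\<bar> powr p)}"

text \<open>The operations below are computed on a chosen representative; the lemmas following the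
  definitions show that the choice is irrelevant.\<close>

definition rep :: "('a \<Rightarrow> real) set \<Rightarrow> 'a \<Rightarrow> real" where
  "rep u = (SOME f. f \<in> u)"

definition Lp_zero :: "'a measure \<Rightarrow> ('a \<Rightarrow> real) set" where
  "Lp_zero M = ae_class M (\<lambda>x. 0)"

definition Lp_add :: "'a measure \<Rightarrow> ('a \<Rightarrow> real) set \<Rightarrow> ('a \<Rightarrow> real) set \<Rightarrow> ('a \<Rightarrow> real) set" where
  "Lp_add M u v = ae_class M (\<lambda>x. rep u x + rep v x)"

definition Lp_diff :: "'a measure \<Rightarrow> ('a \<Rightarrow> real) set \<Rightarrow> ('a \<Rightarrow> real) set \<Rightarrow> ('a \<Rightarrow> real) set" where
  "Lp_diff M u v = ae_class M (\<lambda>x. rep u x - rep v x)"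

definition Lp_scale :: "'a measure \<Rightarrow> real \<Rightarrow> ('a \<Rightarrow> real) set \<Rightarrow> ('a \<Rightarrow> real) set" where
  "Lp_scale M c u = ae_class M (\<lambda>x. c * rep u x)"

definition Lp_norm :: "'a measure \<Rightarrow> real \<Rightarrow> ('a \<Rightarrow> real) set \<Rightarrow> real" where
  "Lp_norm M p u = (\<integral>x. \<bar>rep u x\<bar> powr p \<partial>M) powr (1 / p)"

definition Lp_dist :: "'a measure \<Rightarrow> real \<Rightarrow> ('a \<Rightarrow> real) set \<Rightarrow> ('a \<Rightarrow> real) set \<Rightarrow> real" where
  "Lp_dist M p u v =
     (if p \<ge> 1 then Lp_norm M p (Lp_diff M u v) else Lp_norm M p (Lp_diff M u v) powr p)"

lemma ae_class_eqI:
  "(AE x in M. f x = g x) \<Longrightarrow> ae_class M f = ae_class M g"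
  unfolding ae_class_def by (auto elim: AE_mp)

lemma ae_class_eq_iff:
  assumes "f \<in> borel_measurable M"
  shows "ae_class M f = ae_class M g \<longleftrightarrow> (AE x in M. f x = g x)"
proof
  assume eq: "ae_class M f = ae_class M g"
  have "f \<in> ae_class M f" using assms by (simp add: ae_class_def)
  then show "AE x in M. f x = g x" unfolding eq by (simp add: ae_class_def)
qed (rule ae_class_eqI)

lemma rep_ae_class:
  assumes "f \<in> borel_measurable M"
  shows "rep (ae_class M f) \<in> borel_measurable M" "AE x in M. rep (ae_class M f) x = f x"
proof -
  have "f \<in> ae_class M f" using assms by (simp add: ae_class_def)
  then have "rep (ae_class M f) \<in> ae_class M f" unfolding rep_def by (rule someI[where P = "\<lambda>h. h \<in> ae_class M f"])
  then show "rep (ae_class M f) \<in> borel_measurable M" "AE x in M. rep (ae_class M f) x = f x"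
    by (simp_all add: ae_class_def)
qed

lemma rep_Lp:
  assumes "u \<in> Lp_space M p"
  shows "rep u \<in> borel_measurable M" "integrable M (\<lambda>x. \<bar>rep u x\<bar> powr p)"
    "ae_class M (rep u) = u"
proof -
  obtain f where f: "f \<in> borel_measurable M" "integrable M (\<lambda>x. \<bar>f x\<bar> powr p)"
    and u: "u = ae_class M f"
    using assms by (auto simp: Lp_space_def)
  note r = rep_ae_class[OF f(1), folded u]
  show [measurable]: "rep u \<in> borel_measurable M" by (rule r(1))
  have "AE x in M. \<bar>f x\<bar> powr p = \<bar>rep u x\<bar> powr p" using r(2) by eventually_elim simp
  from integrable_cong_AE_imp[OF f(2) _ this]
  show "integrable M (\<lambda>x. \<bar>rep u x\<bar> powr p)" by simp
  show "ae_class M (rep u) = u" using ae_class_eqI[OF r(2)] u by simp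
qed

lemma Lp_add_ae_class:
  assumes "f \<in> borel_measurable M" "g \<in> borel_measurable M"
  shows "Lp_add M (ae_class M f) (ae_class M g) = ae_class M (\<lambda>x. f x + g x)"
  unfolding Lp_add_def
  using rep_ae_class(2)[OF assms(1)] rep_ae_class(2)[OF assms(2)]
  by (intro ae_class_eqI, eventually_elim) simp

lemma Lp_diff_ae_class:
  assumes "f \<in> borel_measurable M" "g \<in> borel_measurable M"
  shows "Lp_diff M (ae_class M f) (ae_class M g) = ae_class M (\<lambda>x. f x - g x)"
  unfolding Lp_diff_def
  using rep_ae_class(2)[OF assms(1)] rep_ae_class(2)[OF assms(2)]
  by (intro ae_class_eqI, eventually_elim) simp

lemma Lp_scale_ae_class:
  assumes "f \<in> borel_measurable M"
  shows "Lp_scale M c (ae_class M f) = ae_class M (\<lambda>x. c * f x)"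
  unfolding Lp_scale_def
  using rep_ae_class(2)[OF assms] by (intro ae_class_eqI, eventually_elim) simp

lemma Lp_norm_ae_class:
  assumes [measurable]: "f \<in> borel_measurable M"
  shows "Lp_norm M p (ae_class M f) = (\<integral>x. \<bar>f x\<bar> powr p \<partial>M) powr (1 / p)"
proof -
  note [measurable] = rep_ae_class(1)[OF assms]
  have "AE x in M. \<bar>rep (ae_class M f) x\<bar> powr p = \<bar>f x\<bar> powr p"
    using rep_ae_class(2)[OF assms] by eventually_elim simp
  then have "(\<integral>x. \<bar>rep (ae_class M f) x\<bar> powr p \<partial>M) = (\<integral>x. \<bar>f x\<bar> powr p \<partial>M)"
    by (intro integral_cong_AE) measurable
  then show ?thesis by (simp add: Lp_norm_def)
qed

lemma L1_dist_eq:
  assumes "u \<in> Lp_space M 1" "v \<in> Lp_space M 1"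
  shows "Lp_dist M 1 u v = (\<integral>x. \<bar>rep u x - rep v x\<bar> \<partial>M)"
proof -
  note [measurable] = rep_Lp(1)[OF assms(1)] rep_Lp(1)[OF assms(2)]
  show ?thesis
    unfolding Lp_dist_def Lp_diff_def by (simp add: Lp_norm_ae_class)
qed

text \<open>In particular the topology of \<open>L\<^sup>1\<close> used below is that of a metric space.\<close>

lemma Metric_space_L1: "Metric_space (Lp_space M 1) (Lp_dist M 1)"
proof
  have int: "integrable M (rep u)" if "u \<in> Lp_space M 1" for u
    using rep_Lp[OF that] by (simp add: integrable_abs_iff)
  show "0 \<le> Lp_dist M 1 u v" for u v
    by (simp add: Lp_dist_def Lp_norm_def)
  show "Lp_dist M 1 u v = Lp_dist M 1 v u" for u v
  proof -
    have sym: "Lp_norm M 1 (ae_class M h) = Lp_norm M 1 (ae_class M (\<lambda>x. - h x))" for h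
    proof (cases "\<exists>g \<in> borel_measurable M. AE x in M. g x = h x")
      case True
      then obtain g where g: "g \<in> borel_measurable M" "AE x in M. g x = h x" by blast
      have "AE x in M. - g x = - h x" using g(2) by eventually_elim simp
      then have "ae_class M h = ae_class M g" "ae_class M (\<lambda>x. - h x) = ae_class M (\<lambda>x. - g x)"
        using g(2) ae_class_eqI by metis+
      with g(1) show ?thesis by (simp add: Lp_norm_ae_class)
    next
      case False
      have "\<not> (AE x in M. g x = - h x)" if g: "g \<in> borel_measurable M" for g
      proof
        assume "AE x in M. g x = - h x"
        then have "AE x in M. - g x = h x" by eventually_elim simp
        with False g show False by (metis borel_measurable_uminus)
      qed
      with False have "ae_class M h = {}" "ae_class M (\<lambda>x. - h x) = {}"
        by (auto simp: ae_class_def)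
      then show ?thesis by simp
    qed
    show ?thesis using sym[of "\<lambda>x. rep u x - rep v x"] by (simp add: Lp_dist_def Lp_diff_def)
  qed
  fix u v assume u: "u \<in> Lp_space M 1" and v: "v \<in> Lp_space M 1"
  have "Lp_dist M 1 u v = 0 \<longleftrightarrow> (AE x in M. rep u x = rep v x)"
    unfolding L1_dist_eq[OF u v]
    by (subst integral_nonneg_eq_0_iff_AE) (use int[OF u] int[OF v] in auto)
  also have "\<dots> \<longleftrightarrow> u = v"
    using ae_class_eq_iff[OF rep_Lp(1)[OF u], of "rep v"] rep_Lp(3)[OF u] rep_Lp(3)[OF v] by simp
  finally show "Lp_dist M 1 u v = 0 \<longleftrightarrow> u = v" .
  fix w assume w: "w \<in> Lp_space M 1"
  have "(\<integral>x. \<bar>rep u x - rep w x\<bar> \<partial>M) \<le>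
      (\<integral>x. \<bar>rep u x - rep v x\<bar> + \<bar>rep v x - rep w x\<bar> \<partial>M)"
    using int[OF u] int[OF v] int[OF w] by (intro integral_mono) auto
  also have "\<dots> = (\<integral>x. \<bar>rep u x - rep v x\<bar> \<partial>M) + (\<integral>x. \<bar>rep v x - rep w x\<bar> \<partial>M)"
    using int[OF u] int[OF v] int[OF w] by (intro Bochner_Integration.integral_add) auto
  finally show "Lp_dist M 1 u w \<le> Lp_dist M 1 u v + Lp_dist M 1 v w"
    by (simp add: L1_dist_eq u v w)
qed


section \<open>Actions on metric spaces\<close>

text \<open>The action itself is the library's \<^const>\<open>group_action\<close>; \<open>d\<close> is only evaluated on \<open>Y\<close>.\<close>

definition uniformly_Lipschitz_on ::
  "('g, 'r) monoid_scheme \<Rightarrow> 'y set \<Rightarrow> ('y \<Rightarrow> 'y \<Rightarrow> real) \<Rightarrow> ('g \<Rightarrow> 'y \<Rightarrow> 'y) \<Rightarrow> bool" where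
  "uniformly_Lipschitz_on G Y d \<phi> \<longleftrightarrow>
     (\<exists>C\<ge>1. \<forall>s\<in>carrier G. \<forall>x\<in>Y. \<forall>y\<in>Y. d (\<phi> s x) (\<phi> s y) \<le> C * d x y)"

definition proper_on ::
  "('g, 'r) monoid_scheme \<Rightarrow> 'y set \<Rightarrow> ('y \<Rightarrow> 'y \<Rightarrow> real) \<Rightarrow> ('g \<Rightarrow> 'y \<Rightarrow> 'y) \<Rightarrow> bool" where
  "proper_on G Y d \<phi> \<longleftrightarrow>
     (\<forall>x\<in>Y. \<forall>R>0. finite {s \<in> carrier G. d (\<phi> s x) x \<le> R})"


section \<open>Affine actions on closed subspaces of \<open>L\<^sup>1\<close>\<close>

definition closed_subspace_L1 :: "'a measure \<Rightarrow> ('a \<Rightarrow> real) set set \<Rightarrow> bool" where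
  "closed_subspace_L1 M E \<longleftrightarrow>
     E \<subseteq> Lp_space M 1 \<and> Lp_zero M \<in> E \<and>
     (\<forall>u\<in>E. \<forall>v\<in>E. Lp_add M u v \<in> E) \<and> (\<forall>c. \<forall>u\<in>E. Lp_scale M c u \<in> E) \<and>
     closedin (Metric_space.mtopology (Lp_space M 1) (Lp_dist M 1)) E"

definition bounded_linear_L1 ::
  "'a measure \<Rightarrow> ('a \<Rightarrow> real) set set \<Rightarrow> (('a \<Rightarrow> real) set \<Rightarrow> ('a \<Rightarrow> real) set) \<Rightarrow> bool" where
  "bounded_linear_L1 M E T \<longleftrightarrow>
     T \<in> E \<rightarrow> E \<and>
     (\<forall>u\<in>E. \<forall>v\<in>E. T (Lp_add M u v) = Lp_add M (T u) (T v)) \<and>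
     (\<forall>c. \<forall>u\<in>E. T (Lp_scale M c u) = Lp_scale M c (T u)) \<and>
     (\<exists>K. \<forall>u\<in>E. Lp_norm M 1 (T u) \<le> K * Lp_norm M 1 u)"

text \<open>\<open>GL(E)\<close>, with composition inherited from the group of bijections of \<open>E\<close>.\<close>

definition GL_L1 ::
  "'a measure \<Rightarrow> ('a \<Rightarrow> real) set set \<Rightarrow> (('a \<Rightarrow> real) set \<Rightarrow> ('a \<Rightarrow> real) set) monoid" where
  "GL_L1 M E = (BijGroup E)
     \<lparr>carrier := {T \<in> Bij E. bounded_linear_L1 M E T \<and> bounded_linear_L1 M E (inv_into E T)}\<rparr>"

definition affine_data_L1 ::
  "('g, 'r) monoid_scheme \<Rightarrow> 'a measure \<Rightarrow> ('a \<Rightarrow> real) set set \<Rightarrow>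
     ('g \<Rightarrow> ('a \<Rightarrow> real) set \<Rightarrow> ('a \<Rightarrow> real) set) \<Rightarrow> ('g \<Rightarrow> ('a \<Rightarrow> real) set) \<Rightarrow> bool" where
  "affine_data_L1 G M E \<pi> b \<longleftrightarrow>
     \<pi> \<in> hom G (GL_L1 M E) \<and> b \<in> carrier G \<rightarrow> E \<and>
     (\<forall>s\<in>carrier G. \<forall>t\<in>carrier G. b (s \<otimes>\<^bsub>G\<^esub> t) = Lp_add M (\<pi> s (b t)) (b s))"

definition affine_map_L1 ::
  "'a measure \<Rightarrow> ('a \<Rightarrow> real) set set \<Rightarrow>
     ('g \<Rightarrow> ('a \<Rightarrow> real) set \<Rightarrow> ('a \<Rightarrow> real) set) \<Rightarrow> ('g \<Rightarrow> ('a \<Rightarrow> real) set) \<Rightarrow>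
     'g \<Rightarrow> ('a \<Rightarrow> real) set \<Rightarrow> ('a \<Rightarrow> real) set" where
  "affine_map_L1 M E \<pi> b s = (\<lambda>v\<in>E. Lp_add M (\<pi> s v) (b s))"

text \<open>The formula of \<^const>\<open>affine_map_L1\<close> is indeed an action.\<close>

lemma affine_map_L1_group_action:
  assumes G: "group G" and E: "closed_subspace_L1 M E" and aff: "affine_data_L1 G M E \<pi> b"
  shows "group_action G E (affine_map_L1 M E \<pi> b)"
proof -
  interpret group G by (rule G)
  interpret B: group "BijGroup E" by (rule group_BijGroup)
  let ?a = "Lp_add M" and ?s = "affine_map_L1 M E \<pi> b"
  have EL: "u \<in> Lp_space M 1" if "u \<in> E" for u
    using that E by (auto simp: closed_subspace_L1_def)
  note [measurable] = rep_Lp(1)[OF EL]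
  have add: "?a u v \<in> E" if "u \<in> E" "v \<in> E" for u v
    using that E by (auto simp: closed_subspace_L1_def)
  have assoc: "?a (?a u v) w = ?a u (?a v w)" if "u \<in> E" "v \<in> E" "w \<in> E" for u v w
  proof -
    have "?a (?a (ae_class M (rep u)) (ae_class M (rep v))) (ae_class M (rep w)) =
      ?a (ae_class M (rep u)) (?a (ae_class M (rep v)) (ae_class M (rep w)))"
      using that by (simp add: Lp_add_ae_class rep_Lp(1)[OF EL] add.assoc)
    then show ?thesis using that by (simp add: rep_Lp(3)[OF EL])
  qed
  have cancel: "u = ae_class M (\<lambda>x. 0)" if "u \<in> E" "w \<in> E" "?a u w = w" for u w
  proof -
    have "ae_class M (\<lambda>x. rep u x + rep w x) = ae_class M (rep w)"
      using that by (simp add: Lp_add_def[symmetric] rep_Lp(3)[OF EL])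
    then have "AE x in M. rep u x + rep w x = rep w x"
      using that by (subst (asm) ae_class_eq_iff) auto
    then have "AE x in M. rep u x = 0" by eventually_elim simp
    then have "ae_class M (rep u) = ae_class M (\<lambda>x. 0)" by (rule ae_class_eqI)
    then show ?thesis using that(1) by (simp add: rep_Lp(3)[OF EL])
  qed
  have zero: "?a u (ae_class M (\<lambda>x. 0)) = u" if "u \<in> E" for u
  proof -
    have "?a (ae_class M (rep u)) (ae_class M (\<lambda>x. 0)) = ae_class M (rep u)"
      using that by (simp add: Lp_add_ae_class)
    then show ?thesis using that by (simp add: rep_Lp(3)[OF EL])
  qed
  have pB: "\<pi> s \<in> Bij E" and plin: "bounded_linear_L1 M E (\<pi> s)" if "s \<in> carrier G" for s
    using aff that by (auto simp: affine_data_L1_def GL_L1_def hom_def)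
  have pE: "\<pi> s v \<in> E" if "s \<in> carrier G" "v \<in> E" for s v
    using pB[OF that(1)] that(2) by (auto dest: Bij_imp_funcset)
  have padd: "\<pi> s (?a u v) = ?a (\<pi> s u) (\<pi> s v)" if "s \<in> carrier G" "u \<in> E" "v \<in> E" for s u v
    using plin[OF that(1)] that by (auto simp: bounded_linear_L1_def)
  have pmult: "\<pi> (s \<otimes>\<^bsub>G\<^esub> t) v = \<pi> s (\<pi> t v)"
    if "s \<in> carrier G" "t \<in> carrier G" "v \<in> E" for s t v
  proof -
    have "\<pi> (s \<otimes>\<^bsub>G\<^esub> t) = \<pi> s \<otimes>\<^bsub>GL_L1 M E\<^esub> \<pi> t"
      using aff that by (auto simp: affine_data_L1_def hom_def)
    then show ?thesis using that pB by (simp add: GL_L1_def BijGroup_def compose_def)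
  qed
  have bE: "b s \<in> E" if "s \<in> carrier G" for s
    using aff that by (auto simp: affine_data_L1_def)
  have bmult: "b (s \<otimes>\<^bsub>G\<^esub> t) = ?a (\<pi> s (b t)) (b s)"
    if "s \<in> carrier G" "t \<in> carrier G" for s t
    using aff that by (auto simp: affine_data_L1_def)
  have sE: "?s s v \<in> E" if "s \<in> carrier G" "v \<in> E" for s v
    using that by (simp add: affine_map_L1_def add pE bE)
  have smult: "?s (s \<otimes>\<^bsub>G\<^esub> t) v = ?s s (?s t v)"
    if "s \<in> carrier G" "t \<in> carrier G" "v \<in> E" for s t v
    using that by (simp add: affine_map_L1_def add pE bE pmult bmult padd assoc)
  have p1: "\<pi> \<one>\<^bsub>G\<^esub> v = v" if "v \<in> E" for v
  proof -
    have "\<pi> \<one>\<^bsub>G\<^esub> (\<pi> \<one>\<^bsub>G\<^esub> v) = \<pi> \<one>\<^bsub>G\<^esub> v" using pmult[of "\<one>\<^bsub>G\<^esub>" "\<one>\<^bsub>G\<^esub>" v] that by simp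
    moreover have "inj_on (\<pi> \<one>\<^bsub>G\<^esub>) E" using pB[of "\<one>\<^bsub>G\<^esub>"] by (simp add: Bij_def bij_betw_def)
    ultimately show ?thesis using that pE[of "\<one>\<^bsub>G\<^esub>" v] by (auto dest: inj_onD)
  qed
  have "?a (b \<one>\<^bsub>G\<^esub>) (b \<one>\<^bsub>G\<^esub>) = b \<one>\<^bsub>G\<^esub>"
    using bmult[of "\<one>\<^bsub>G\<^esub>" "\<one>\<^bsub>G\<^esub>"] p1[of "b \<one>\<^bsub>G\<^esub>"] bE[of "\<one>\<^bsub>G\<^esub>"] by simp
  then have b1: "b \<one>\<^bsub>G\<^esub> = ae_class M (\<lambda>x. 0)" using cancel bE by blast
  have s1: "?s \<one>\<^bsub>G\<^esub> v = v" if "v \<in> E" for v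
    using that by (simp add: affine_map_L1_def p1 b1 zero)
  have sB: "?s s \<in> Bij E" if s: "s \<in> carrier G" for s
  proof -
    have "bij_betw (?s s) E E"
    proof (rule bij_betw_byWitness[where f' = "?s (inv\<^bsub>G\<^esub> s)"])
      show "\<forall>v\<in>E. ?s (inv\<^bsub>G\<^esub> s) (?s s v) = v" "\<forall>v\<in>E. ?s s (?s (inv\<^bsub>G\<^esub> s) v) = v"
        using s by (simp_all add: smult[symmetric] s1)
      show "?s s ` E \<subseteq> E" "?s (inv\<^bsub>G\<^esub> s) ` E \<subseteq> E" using s sE by auto
    qed
    then show ?thesis by (simp add: Bij_def affine_map_L1_def)
  qed
  have "?s \<in> hom G (BijGroup E)"
  proof (rule homI)
    fix s t assume st: "s \<in> carrier G" "t \<in> carrier G"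
    show "?s s \<in> carrier (BijGroup E)" using sB[OF st(1)] by (simp add: BijGroup_def)
    have "?s (s \<otimes>\<^bsub>G\<^esub> t) = compose E (?s s) (?s t)"
    proof (rule extensionalityI[of _ E])
      show "?s (s \<otimes>\<^bsub>G\<^esub> t) \<in> extensional E" by (simp add: affine_map_L1_def)
    qed (use st in \<open>simp_all add: smult compose_def\<close>)
    then show "?s (s \<otimes>\<^bsub>G\<^esub> t) = ?s s \<otimes>\<^bsub>BijGroup E\<^esub> ?s t"
      using sB st by (simp add: BijGroup_def)
  qed
  then show ?thesis
    by (intro group_action.intro group_hom.intro group_hom_axioms.intro) unfold_locales
qed

text \<open>HOL cannot quantify existentially over types, so \<open>there is a measure space\<close> has to name the type
  of its points; \<^typ>\<open>nat \<Rightarrow> real\<close> loses nothing. An affine action of a countable group on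
  \<open>E \<subseteq> L\<^sup>1(\<Omega>, \<mu>)\<close> restricts to the closed linear span of the values of \<open>b\<close>. If \<open>f\<^sub>0, f\<^sub>1, \<dots>\<close>
  enumerate these values, then \<open>x \<mapsto> (f\<^sub>n x)\<^sub>n\<close> pushes \<open>\<mu>\<close> forward to a measure on
  \<^typ>\<open>nat \<Rightarrow> real\<close>, and that span is isometric to the closed span in its \<open>L\<^sup>1\<close> of the coordinates.\<close>

end

theory Submission
  imports Defs "HOL-Probability.Probability"
begin

text \<open>Fix a point of \<open>A\<close>, let \<open>x\<^sub>s\<close> be its translate by \<open>s\<close>, and put
  \<open>D(s, t) = \<integral> \<bar>x\<^sub>s - x\<^sub>t\<bar>\<^sup>p\<close>. Since \<open>p \<le> 2\<close>, this kernel is conditionally negative definite, and the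
  action distorts it by a bounded factor. Composing it with a function that grows like a logarithm
  gives a kernel \<open>\<kappa>\<close> which is still conditionally negative definite and proper, but is distorted only by
  a bounded additive error: \<open>\<bar>\<kappa>(gs, gt) - \<kappa>(s, t)\<bar> \<le> L\<close>. For finitely supported \<open>c\<close> with \<open>\<Sum> c = 0\<close> consider
  the norm
  \<open>(- \<Sum>\<^sub>s \<Sum>\<^sub>t c\<^sub>s c\<^sub>t \<kappa>(s, t))\<^bsup>1/2\<^esup> + \<Sum> \<bar>c\<^sub>t\<bar>\<close>.
  Translating \<open>c\<close> changes the quadratic form by at most \<open>L (\<Sum> \<bar>c\<^sub>t\<bar>)\<^sup>2\<close>, which the second term
  absorbs, so the translations are uniformly bounded for it. The norm lives on a subspace of
  \<open>L\<^sup>2 \<oplus> \<ell>\<^sup>1\<close>, hence of an \<open>L\<^sup>1\<close> space by Gaussian variables, and the cocycle is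
  \<open>b(g) = \<delta>\<^sub>g - \<delta>\<^sub>1\<close>.\<close>

section \<open>Positive and conditionally negative definite kernels\<close>

text \<open>The obstacle is that a Lipschitz bound on an orbit says nothing about linear
  combinations: a multiplicative distortion of the kernel does not bound its quadratic form at
  coefficients of mixed sign, so translations need not be bounded on the Hilbert space attached to
  D. An error bounded entry by entry is harmless, which is why a logarithm, turning factors into
  summands, is needed. It has to be a Bernstein function for conditional negativity to survive. The
  function log(1 + l) would serve as well; in the sum over dyadic rates that defines
  \<open>slow\<close>, doubling l merely shifts the index. The summand added for boundedness does
  not help properness: \<delta>_g - \<delta>_1 has l1 norm 2 for every g other than the identity, so
  displacements tend to infinity through \<kappa> alone. Enumerating the countable group makes the
  Gram vectors of the kernel triangular, hence finitely supported, so only finite sums of Gaussian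
  variables occur. The quadratic term then carries the factor sqrt(2/pi), the first absolute moment
  of a standard Gaussian.\<close>

text \<open>The points \<open>x i\<close> may repeat, so that pulling a kernel back along any map is immediate.\<close>

definition psd_kernel :: "('i \<Rightarrow> 'i \<Rightarrow> real) \<Rightarrow> bool" where
  "psd_kernel K \<longleftrightarrow> (\<forall>s t. K s t = K t s) \<and>
     (\<forall>(n::nat) x c. 0 \<le> (\<Sum>i<n. \<Sum>j<n. c i * c j * K (x i) (x j)))"

definition cnd_kernel :: "('i \<Rightarrow> 'i \<Rightarrow> real) \<Rightarrow> bool" where
  "cnd_kernel \<kappa> \<longleftrightarrow> (\<forall>s t. \<kappa> s t = \<kappa> t s) \<and> (\<forall>s. \<kappa> s s = 0) \<and>
     (\<forall>(n::nat) x c. (\<Sum>i<n. c i) = 0 \<longrightarrow> (\<Sum>i<n. \<Sum>j<n. c i * c j * \<kappa> (x i) (x j)) \<le> 0)"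

lemma psd_kernelD:
  fixes n :: nat
  assumes "psd_kernel K" shows "0 \<le> (\<Sum>i<n. \<Sum>j<n. c i * c j * K (x i) (x j))"
  using assms unfolding psd_kernel_def by simp

lemma psd_kernel_sym: "psd_kernel K \<Longrightarrow> K s t = K t s"
  unfolding psd_kernel_def by simp

lemma cnd_kernelD:
  fixes n :: nat
  assumes "cnd_kernel \<kappa>" "(\<Sum>i<n. c i) = 0"
  shows "(\<Sum>i<n. \<Sum>j<n. c i * c j * \<kappa> (x i) (x j)) \<le> 0"
  using assms unfolding cnd_kernel_def by simp

lemma cnd_kernel_sym: "cnd_kernel \<kappa> \<Longrightarrow> \<kappa> s t = \<kappa> t s"
  and cnd_kernel_diag: "cnd_kernel \<kappa> \<Longrightarrow> \<kappa> s s = 0"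
  unfolding cnd_kernel_def by simp_all

lemma psd_kernel_pullback: "psd_kernel K \<Longrightarrow> psd_kernel (\<lambda>s t. K (f s) (f t))"
  unfolding psd_kernel_def by fast

lemma psd_kernel_diag_nonneg: "psd_kernel K \<Longrightarrow> 0 \<le> K s s"
  using psd_kernelD[where n = 1 and c = "\<lambda>_. 1" and x = "\<lambda>_. s" and K = K]
  by (simp add: lessThan_Suc[of 0])

section \<open>Schur complements and triangular Gram factorisation\<close>

lemma psd_kernel_zero_row:
  assumes K: "psd_kernel K" and z: "K s s = 0"
  shows "K s t = 0"
proof (rule ccontr)
  assume nz: "K s t \<noteq> 0"
  \<comment> \<open>On the weights a at s and 1 at t the form is 2 a K(s,t) + K(t,t), affine in a;
    this a is the point where it equals -1.\<close>
  define a where "a = - (K t t + 1) / (2 * K s t)"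
  define c where "c = (\<lambda>i::nat. if i = 0 then a else 1)"
  define x where "x = (\<lambda>i::nat. if i = 0 then s else t)"
  have "0 \<le> (\<Sum>i<2. \<Sum>j<2. c i * c j * K (x i) (x j))" by (rule psd_kernelD[OF K])
  also have "\<dots> = 2 * a * K s t + K t t"
    using z psd_kernel_sym[OF K, of t s] by (simp add: c_def x_def numeral_2_eq_2)
  also have "\<dots> = -1" using nz by (simp add: a_def field_simps)
  finally show False by simp
qed

text \<open>The complement at c is the value of the form of K after z is added with the coefficient
  that minimises it, namely -S / K(z,z). If K(z,z) = 0, division by zero yields 0 and the complement
  is K itself.\<close>

lemma psd_kernel_Schur_complement:
  assumes K: "psd_kernel K"
  shows "psd_kernel (\<lambda>s t. K s t - K s z * K z t / K z z)"
  unfolding psd_kernel_def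
proof (intro conjI allI)
  fix s t show "K s t - K s z * K z t / K z z = K t s - K t z * K z s / K z z"
    by (metis psd_kernel_sym[OF K] mult.commute)
next
  fix n and x :: "nat \<Rightarrow> 'a" and c :: "nat \<Rightarrow> real"
  define S where "S = (\<Sum>i<n. c i * K (x i) z)"
  define d where "d = (\<lambda>i. if i = n then - S / K z z else c i)"
  define y where "y = (\<lambda>i. if i = n then z else x i)"
  have S': "(\<Sum>j<n. c j * K z (x j)) = S" unfolding S_def by (simp add: psd_kernel_sym[OF K, of z])
  have dq: "(\<Sum>j<n. b * c j * K u (x j)) = b * (\<Sum>j<n. c j * K u (x j))" for b u
    by (simp add: sum_distrib_left mult.assoc)
  have "0 \<le> (\<Sum>i<Suc n. \<Sum>j<Suc n. d i * d j * K (y i) (y j))" by (rule psd_kernelD[OF K])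
  also have "\<dots> = (\<Sum>i<n. \<Sum>j<n. c i * c j * K (x i) (x j)) + (\<Sum>i<n. c i * (- S / K z z) * K (x i) z)
      + ((\<Sum>j<n. (- S / K z z) * c j * K z (x j)) + (- S / K z z) * (- S / K z z) * K z z)"
    by (simp add: d_def y_def sum.distrib sum_subtractf sum_negf)
  also have "(\<Sum>i<n. c i * (- S / K z z) * K (x i) z) = (- S / K z z) * S"
    unfolding S_def sum_distrib_left by (intro sum.cong) auto
  also have "(\<Sum>j<n. (- S / K z z) * c j * K z (x j)) = (- S / K z z) * S" unfolding dq S' ..
  also have "(\<Sum>i<n. \<Sum>j<n. c i * c j * K (x i) (x j)) + (- S / K z z) * S + ((- S / K z z) * S + (- S / K z z) * (- S / K z z) * K z z)
     = (\<Sum>i<n. \<Sum>j<n. c i * c j * K (x i) (x j)) - S * S / K z z"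
    by (cases "K z z = 0") (simp_all add: field_simps)
  also have "S * S / K z z = (\<Sum>i<n. \<Sum>j<n. c i * c j * (K (x i) z * K z (x j) / K z z))"
  proof -
    have "S * S = (\<Sum>i<n. c i * K (x i) z) * (\<Sum>j<n. c j * K z (x j))" unfolding S' S_def ..
    also have "\<dots> = (\<Sum>i<n. \<Sum>j<n. c i * K (x i) z * (c j * K z (x j)))" by (rule sum_product)
    finally show ?thesis by (simp add: sum_divide_distrib mult_ac)
  qed
  finally show "0 \<le> (\<Sum>i<n. \<Sum>j<n. c i * c j * (K (x i) (x j) - K (x i) z * K z (x j) / K z z))"
    by (simp add: right_diff_distrib sum_subtractf)
qed

text \<open>Cholesky factorisation by successive Schur complements: \<open>schur_seq K k\<close> is what remains of
  \<open>K\<close> after the points \<open>0, \<dots>, k - 1\<close> have been eliminated. A vanishing pivot is harmless, since its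
  whole row vanishes.\<close>

fun schur_seq :: "(nat \<Rightarrow> nat \<Rightarrow> real) \<Rightarrow> nat \<Rightarrow> nat \<Rightarrow> nat \<Rightarrow> real" where
  "schur_seq K 0 s t = K s t"
| "schur_seq K (Suc k) s t =
     schur_seq K k s t - schur_seq K k s k * schur_seq K k k t / schur_seq K k k k"

lemma psd_schur_seq: "psd_kernel K \<Longrightarrow> psd_kernel (schur_seq K k)"
proof (induction k)
  case (Suc k)
  have "schur_seq K (Suc k) = (\<lambda>s t. schur_seq K k s t - schur_seq K k s k * schur_seq K k k t / schur_seq K k k k)"
    by (intro ext) simp
  then show ?case using psd_kernel_Schur_complement[OF Suc.IH[OF Suc.prems]] by simp
next
  case 0
  have "schur_seq K 0 = K" by (intro ext) simp
  with 0 show ?case by simp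
qed

lemma schur_seq_zero:
  assumes K: "psd_kernel K"
  shows "m < k \<Longrightarrow> schur_seq K k m t = 0"
proof (induction k arbitrary: t)
  case (Suc k)
  show ?case
  proof (cases "m = k")
    case True
    then show ?thesis
      using psd_kernel_zero_row[OF psd_schur_seq[OF K], of k k t] by (cases "schur_seq K k k k = 0") auto
  next
    case False
    then show ?thesis using Suc by simp
  qed
qed simp

text \<open>Triangularity makes each Gram vector finitely supported, so any truncation
  \<open>l\<close> beyond one of the two indices gives the exact inner product and no Hilbert space
  is needed.\<close>

theorem psd_kernel_Gram:
  fixes K :: "nat \<Rightarrow> nat \<Rightarrow> real"
  assumes K: "psd_kernel K"
  obtains L :: "nat \<Rightarrow> nat \<Rightarrow> real" where
    "\<And>m k. m < k \<Longrightarrow> L m k = 0"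
    "\<And>m n l. m < l \<Longrightarrow> K m n = (\<Sum>k<l. L m k * L n k)"
proof
  define L where "L = (\<lambda>m k. schur_seq K k m k / sqrt (schur_seq K k k k))"
  show "L m k = 0" if "m < k" for m k
    using schur_seq_zero[OF K that] by (simp add: L_def)
  \<comment> \<open>Each elimination moves one product of entries of \<open>L\<close> out of the
    remainder; once index \<open>m\<close> has been eliminated its row in the remainder is
    zero.\<close>
  have step: "K m n = (\<Sum>k<l. L m k * L n k) + schur_seq K l m n" for m n l
  proof (induction l)
    case (Suc l)
    have "L m l * L n l = schur_seq K l m l * schur_seq K l l n / schur_seq K l l l"
      using psd_kernel_diag_nonneg[OF psd_schur_seq[OF K], of l l]
        psd_kernel_sym[OF psd_schur_seq[OF K], of l n l]
      by (simp add: L_def)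
    then show ?case using Suc by simp
  qed simp
  show "K m n = (\<Sum>k<l. L m k * L n k)" if "m < l" for m n l
    using step[of m n l] schur_seq_zero[OF K that] by simp
qed

section \<open>Schur products, powers and exponentials of positive kernels\<close>

lemma psd_kernel_mult:
  assumes K: "psd_kernel K" and H: "psd_kernel H"
  shows "psd_kernel (\<lambda>s t. K s t * H s t)"
  unfolding psd_kernel_def
proof (intro conjI allI)
  fix s t show "K s t * H s t = K t s * H t s"
    by (metis psd_kernel_sym[OF K] psd_kernel_sym[OF H])
next
  fix n :: nat and x :: "nat \<Rightarrow> 'a" and c :: "nat \<Rightarrow> real"
  obtain L where L: "\<And>m m' l. m < l \<Longrightarrow> K (x m) (x m') = (\<Sum>k<l. L m k * L m' k)"
    using psd_kernel_Gram[OF psd_kernel_pullback[OF K, of x]] by (metis (no_types))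
  \<comment> \<open>Expanding K by its Gram vectors writes the form of the product as a sum over k
    of forms of H, at the weights \<open>c i * L i k\<close>.\<close>
  have "(\<Sum>i<n. \<Sum>j<n. c i * c j * (K (x i) (x j) * H (x i) (x j))) =
    (\<Sum>i<n. \<Sum>j<n. \<Sum>k<n. (c i * L i k) * (c j * L j k) * H (x i) (x j))"
    by (intro sum.cong refl) (simp add: L[of _ n] sum_distrib_left sum_distrib_right mult_ac)
  also have "\<dots> = (\<Sum>i<n. \<Sum>k<n. \<Sum>j<n. (c i * L i k) * (c j * L j k) * H (x i) (x j))"
    by (intro sum.cong refl sum.swap)
  also have "\<dots> = (\<Sum>k<n. \<Sum>i<n. \<Sum>j<n. (c i * L i k) * (c j * L j k) * H (x i) (x j))"
    by (rule sum.swap)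
  also have "0 \<le> \<dots>" by (intro sum_nonneg psd_kernelD[OF H, where c = "\<lambda>i. c i * L i k" for k])
  finally show "0 \<le> (\<Sum>i<n. \<Sum>j<n. c i * c j * (K (x i) (x j) * H (x i) (x j)))" .
qed

lemma psd_kernel_rank_one: "psd_kernel (\<lambda>s t. f s * f t)"
  unfolding psd_kernel_def
proof (intro conjI allI)
  fix n :: nat and x :: "nat \<Rightarrow> 'a" and c :: "nat \<Rightarrow> real"
  have "(\<Sum>i<n. \<Sum>j<n. c i * c j * (f (x i) * f (x j))) = (\<Sum>i<n. c i * f (x i)) * (\<Sum>i<n. c i * f (x i))"
    by (simp add: sum_product mult_ac)
  then show "0 \<le> (\<Sum>i<n. \<Sum>j<n. c i * c j * (f (x i) * f (x j)))" by simp
qed simp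

lemma psd_kernel_power:
  assumes "psd_kernel K" shows "psd_kernel (\<lambda>s t. K s t ^ m)"
proof (induction m)
  case 0
  show ?case using psd_kernel_rank_one[of "\<lambda>_. 1"] by simp
next
  case (Suc m)
  show ?case using psd_kernel_mult[OF assms Suc] by simp
qed

lemma psd_kernel_add:
  assumes "psd_kernel K" "psd_kernel H" shows "psd_kernel (\<lambda>s t. K s t + H s t)"
  using psd_kernelD[OF assms(1)] psd_kernelD[OF assms(2)] psd_kernel_sym[OF assms(1)] psd_kernel_sym[OF assms(2)]
  unfolding psd_kernel_def by (auto simp: distrib_left sum.distrib intro!: add_nonneg_nonneg)

lemma psd_kernel_scale:
  assumes "psd_kernel K" "0 \<le> a" shows "psd_kernel (\<lambda>s t. a * K s t)"
proof -
  have "(\<Sum>i<n. \<Sum>j<n. c i * c j * (a * K (x i) (x j))) = a * (\<Sum>i<n. \<Sum>j<n. c i * c j * K (x i) (x j))" for n :: nat and c x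
    by (simp add: sum_distrib_left mult_ac)
  then show ?thesis
    using psd_kernelD[OF assms(1)] psd_kernel_sym[OF assms(1)] assms(2) unfolding psd_kernel_def
    by (auto intro!: mult_nonneg_nonneg)
qed

lemma psd_kernel_limit:
  assumes K: "\<And>m. psd_kernel (K m)" and lim: "\<And>s t. (\<lambda>m. K m s t) \<longlonglongrightarrow> H s t"
  shows "psd_kernel H"
  unfolding psd_kernel_def
proof (intro conjI allI)
  fix s t
  have "(\<lambda>m. K m s t) = (\<lambda>m. K m t s)" using psd_kernel_sym[OF K] by blast
  then show "H s t = H t s" using lim[of s t] lim[of t s] LIMSEQ_unique by metis
next
  fix n :: nat and x :: "nat \<Rightarrow> 'a" and c :: "nat \<Rightarrow> real"
  have "(\<lambda>m. \<Sum>i<n. \<Sum>j<n. c i * c j * K m (x i) (x j)) \<longlonglongrightarrow> (\<Sum>i<n. \<Sum>j<n. c i * c j * H (x i) (x j))"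
    by (intro tendsto_intros lim)
  then show "0 \<le> (\<Sum>i<n. \<Sum>j<n. c i * c j * H (x i) (x j))"
    by (rule LIMSEQ_le_const) (use psd_kernelD[OF K] in blast)
qed

lemma psd_kernel_exp:
  assumes "psd_kernel K" shows "psd_kernel (\<lambda>s t. exp (K s t))"
proof (rule psd_kernel_limit)
  fix m
  show "psd_kernel (\<lambda>s t. \<Sum>k<m. K s t ^ k /\<^sub>R fact k)"
  proof (induction m)
    case 0
    show ?case using psd_kernel_rank_one[of "\<lambda>_. 0"] by simp
  next
    case (Suc m)
    then show ?case
      using psd_kernel_add[OF Suc psd_kernel_scale[OF psd_kernel_power[OF assms], of "inverse (fact m)" m]]
      by simp
  qed
next
  fix s t show "(\<lambda>m. \<Sum>k<m. K s t ^ k /\<^sub>R fact k) \<longlonglongrightarrow> exp (K s t)"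
    using exp_converges[of "K s t"] by (simp add: sums_def)
qed

section \<open>Schoenberg's passage between the two kinds of kernel\<close>

lemma psd_kernel_of_cnd:
  assumes k: "cnd_kernel \<kappa>"
  shows "psd_kernel (\<lambda>s t. \<kappa> s e + \<kappa> t e - \<kappa> s t)"
  unfolding psd_kernel_def
proof (intro conjI allI)
  fix s t show "\<kappa> s e + \<kappa> t e - \<kappa> s t = \<kappa> t e + \<kappa> s e - \<kappa> t s" by (simp add: cnd_kernel_sym[OF k, of s t])
next
  fix n :: nat and x :: "nat \<Rightarrow> 'a" and c :: "nat \<Rightarrow> real"
  define S where "S = (\<Sum>i<n. c i)"
  define T where "T = (\<Sum>i<n. c i * \<kappa> (x i) e)"
  define Q where "Q = (\<Sum>i<n. \<Sum>j<n. c i * c j * \<kappa> (x i) (x j))"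
  \<comment> \<open>The weights c need not sum to zero; giving the base point e the extra weight -S
    makes them do so, and its cross terms produce exactly \<kappa>(s,e) + \<kappa>(t,e).\<close>
  define d where "d = (\<lambda>i. if i = n then - S else c i)"
  define y where "y = (\<lambda>i. if i = n then e else x i)"
  have "(\<Sum>i<Suc n. d i) = 0" by (simp add: d_def S_def)
  from cnd_kernelD[OF k this, where x = y]
  have "(\<Sum>i<Suc n. \<Sum>j<Suc n. d i * d j * \<kappa> (y i) (y j)) \<le> 0" .
  also have "(\<Sum>i<Suc n. \<Sum>j<Suc n. d i * d j * \<kappa> (y i) (y j)) =
     Q + (\<Sum>i<n. c i * (- S) * \<kappa> (x i) e) + (\<Sum>j<n. (- S) * c j * \<kappa> e (x j))"
    by (simp add: d_def y_def sum.distrib sum_subtractf sum_negf Q_def cnd_kernel_diag[OF k])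
  also have "(\<Sum>i<n. c i * (- S) * \<kappa> (x i) e) = - S * T"
    unfolding T_def sum_distrib_left by (intro sum.cong) auto
  also have "(\<Sum>j<n. (- S) * c j * \<kappa> e (x j)) = - S * T"
    unfolding T_def sum_distrib_left by (intro sum.cong) (auto simp: cnd_kernel_sym[OF k, of e])
  finally have "0 \<le> S * T + S * T - Q" by simp
  also have "S * T + S * T - Q = (\<Sum>i<n. \<Sum>j<n. c i * c j * (\<kappa> (x i) e + \<kappa> (x j) e - \<kappa> (x i) (x j)))"
  proof -
    have 1: "T * S = (\<Sum>i<n. \<Sum>j<n. c i * \<kappa> (x i) e * c j)" unfolding S_def T_def by (rule sum_product)
    have 2: "S * T = (\<Sum>i<n. \<Sum>j<n. c i * (c j * \<kappa> (x j) e))" unfolding S_def T_def by (rule sum_product)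
    have "S * T + S * T - Q = T * S + S * T - Q" by simp
    also have "\<dots> = (\<Sum>i<n. \<Sum>j<n. c i * c j * (\<kappa> (x i) e + \<kappa> (x j) e - \<kappa> (x i) (x j)))"
      unfolding 1 2 Q_def by (simp add: distrib_left right_diff_distrib sum.distrib sum_subtractf mult_ac)
    finally show ?thesis .
  qed
  finally show "0 \<le> (\<Sum>i<n. \<Sum>j<n. c i * c j * (\<kappa> (x i) e + \<kappa> (x j) e - \<kappa> (x i) (x j)))" .
qed

lemma psd_kernel_exp_cnd:
  assumes k: "cnd_kernel \<kappa>" and r: "0 \<le> r"
  shows "psd_kernel (\<lambda>s t. exp (- r * \<kappa> s t))"
proof -
  fix e :: 'a
  \<comment> \<open>The base point e is arbitrary: its contributions to the exponent are undone by
    the rank one factor.\<close>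
  have "psd_kernel (\<lambda>s t. (exp (- r * \<kappa> s e) * exp (- r * \<kappa> t e)) * exp (r * (\<kappa> s e + \<kappa> t e - \<kappa> s t)))"
    by (intro psd_kernel_mult psd_kernel_rank_one psd_kernel_exp psd_kernel_scale psd_kernel_of_cnd k r)
  also have "(\<lambda>s t. (exp (- r * \<kappa> s e) * exp (- r * \<kappa> t e)) * exp (r * (\<kappa> s e + \<kappa> t e - \<kappa> s t))) =
      (\<lambda>s t. exp (- r * \<kappa> s t))"
    by (intro ext) (simp add: exp_add[symmetric] algebra_simps)
  finally show ?thesis .
qed

lemma cnd_kernel_one_minus_exp:
  assumes k: "cnd_kernel \<kappa>" and r: "0 \<le> r"
  shows "cnd_kernel (\<lambda>s t. 1 - exp (- r * \<kappa> s t))"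
  unfolding cnd_kernel_def
proof (intro conjI allI impI)
  fix n :: nat and x :: "nat \<Rightarrow> 'a" and c :: "nat \<Rightarrow> real" assume z: "(\<Sum>i<n. c i) = 0"
  have "(\<Sum>i<n. \<Sum>j<n. c i * c j * (1 - exp (- r * \<kappa> (x i) (x j)))) =
    (\<Sum>i<n. c i) * (\<Sum>i<n. c i) - (\<Sum>i<n. \<Sum>j<n. c i * c j * exp (- r * \<kappa> (x i) (x j)))"
    by (simp add: sum_product right_diff_distrib sum_subtractf)
  then show "(\<Sum>i<n. \<Sum>j<n. c i * c j * (1 - exp (- r * \<kappa> (x i) (x j)))) \<le> 0"
    using psd_kernelD[OF psd_kernel_exp_cnd[OF k r], where n = n and c = c and x = x] z by simp
qed (simp_all add: cnd_kernel_diag[OF k], metis cnd_kernel_sym[OF k])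

lemma cnd_kernel_integral:
  fixes \<kappa> :: "'a \<Rightarrow> 'i \<Rightarrow> 'i \<Rightarrow> real"
  assumes k: "\<And>w. w \<in> space M \<Longrightarrow> cnd_kernel (\<kappa> w)" and int: "\<And>s t. integrable M (\<lambda>w. \<kappa> w s t)"
  shows "cnd_kernel (\<lambda>s t. \<integral>w. \<kappa> w s t \<partial>M)"
  unfolding cnd_kernel_def
proof (intro conjI allI impI)
  fix s t
  show "(\<integral>w. \<kappa> w s t \<partial>M) = (\<integral>w. \<kappa> w t s \<partial>M)"
    by (intro Bochner_Integration.integral_cong refl cnd_kernel_sym[OF k])
  show "(\<integral>w. \<kappa> w s s \<partial>M) = 0"
    using Bochner_Integration.integral_cong[OF refl, of M "\<lambda>w. \<kappa> w s s" "\<lambda>_. 0"] cnd_kernel_diag[OF k] by simp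
next
  fix n :: nat and x :: "nat \<Rightarrow> 'i" and c :: "nat \<Rightarrow> real" assume z: "(\<Sum>i<n. c i) = 0"
  have "(\<Sum>i<n. \<Sum>j<n. c i * c j * (\<integral>w. \<kappa> w (x i) (x j) \<partial>M)) =
    (\<integral>w. (\<Sum>i<n. \<Sum>j<n. c i * c j * \<kappa> w (x i) (x j)) \<partial>M)"
    by (simp add: int)
  also have "\<dots> \<le> (\<integral>w. 0 \<partial>M)"
    by (intro integral_mono Bochner_Integration.integrable_sum integrable_mult_right int integrable_zero)
      (simp add: cnd_kernelD[OF k z])
  finally show "(\<Sum>i<n. \<Sum>j<n. c i * c j * (\<integral>w. \<kappa> w (x i) (x j) \<partial>M)) \<le> 0" by simp
qed

section \<open>Positivity and closure properties\<close>

lemma cnd_kernel_nonneg: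
  assumes k: "cnd_kernel \<kappa>" shows "0 \<le> \<kappa> s t"
  \<comment> \<open>With base point t, the diagonal entry at s of the positive kernel is twice
    \<kappa>(s,t).\<close>
  using psd_kernel_diag_nonneg[OF psd_kernel_of_cnd[OF k, of t], of s] cnd_kernel_diag[OF k, of s] by simp

lemma cnd_kernel_scale:
  assumes k: "cnd_kernel \<kappa>" and a: "0 \<le> a" shows "cnd_kernel (\<lambda>s t. a * \<kappa> s t)"
  unfolding cnd_kernel_def
proof (intro conjI allI impI)
  fix n :: nat and x :: "nat \<Rightarrow> 'a" and c :: "nat \<Rightarrow> real" assume z: "(\<Sum>i<n. c i) = 0"
  have "(\<Sum>i<n. \<Sum>j<n. c i * c j * (a * \<kappa> (x i) (x j))) = a * (\<Sum>i<n. \<Sum>j<n. c i * c j * \<kappa> (x i) (x j))"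
    by (simp add: sum_distrib_left mult_ac)
  then show "(\<Sum>i<n. \<Sum>j<n. c i * c j * (a * \<kappa> (x i) (x j))) \<le> 0"
    using mult_nonneg_nonpos[OF a cnd_kernelD[OF k z, of x]] by simp
qed (use cnd_kernel_sym[OF k] cnd_kernel_diag[OF k] in auto)

lemma cnd_kernel_add:
  assumes k: "cnd_kernel \<kappa>" and l: "cnd_kernel \<kappa>'" shows "cnd_kernel (\<lambda>s t. \<kappa> s t + \<kappa>' s t)"
  unfolding cnd_kernel_def
proof (intro conjI allI impI)
  fix n :: nat and x :: "nat \<Rightarrow> 'a" and c :: "nat \<Rightarrow> real" assume z: "(\<Sum>i<n. c i) = 0"
  show "(\<Sum>i<n. \<Sum>j<n. c i * c j * (\<kappa> (x i) (x j) + \<kappa>' (x i) (x j))) \<le> 0"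
    using add_nonpos_nonpos[OF cnd_kernelD[OF k z, of x] cnd_kernelD[OF l z, of x]]
    by (simp add: distrib_left sum.distrib)
next
  fix s t show "\<kappa> s t + \<kappa>' s t = \<kappa> t s + \<kappa>' t s"
    by (simp add: cnd_kernel_sym[OF k, of s] cnd_kernel_sym[OF l, of s])
qed (use cnd_kernel_diag[OF k] cnd_kernel_diag[OF l] in auto)

lemma cnd_kernel_limit:
  fixes \<kappa> :: "nat \<Rightarrow> 'i \<Rightarrow> 'i \<Rightarrow> real"
  assumes k: "\<And>m. cnd_kernel (\<kappa> m)" and lim: "\<And>s t. (\<lambda>m. \<kappa> m s t) \<longlonglongrightarrow> \<kappa>' s t"
  shows "cnd_kernel \<kappa>'"
  unfolding cnd_kernel_def
proof (intro conjI allI impI)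
  fix s t
  have "(\<lambda>m. \<kappa> m s t) = (\<lambda>m. \<kappa> m t s)" using cnd_kernel_sym[OF k] by blast
  then show "\<kappa>' s t = \<kappa>' t s" using lim[of s t] lim[of t s] LIMSEQ_unique by metis
  have "(\<lambda>m. \<kappa> m s s) = (\<lambda>m. 0)" using cnd_kernel_diag[OF k] by blast
  then show "\<kappa>' s s = 0" using lim[of s s] LIMSEQ_unique tendsto_const by metis
next
  fix n :: nat and x :: "nat \<Rightarrow> 'i" and c :: "nat \<Rightarrow> real" assume z: "(\<Sum>i<n. c i) = 0"
  have "(\<lambda>m. \<Sum>i<n. \<Sum>j<n. c i * c j * \<kappa> m (x i) (x j)) \<longlonglongrightarrow> (\<Sum>i<n. \<Sum>j<n. c i * c j * \<kappa>' (x i) (x j))"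
    by (intro tendsto_intros lim)
  then show "(\<Sum>i<n. \<Sum>j<n. c i * c j * \<kappa>' (x i) (x j)) \<le> 0"
    by (rule LIMSEQ_le_const2) (use cnd_kernelD[OF k z] in blast)
qed

lemma cnd_kernel_suminf:
  fixes \<kappa> :: "nat \<Rightarrow> 'i \<Rightarrow> 'i \<Rightarrow> real"
  assumes k: "\<And>m. cnd_kernel (\<kappa> m)" and sm: "\<And>s t. summable (\<lambda>m. \<kappa> m s t)"
  shows "cnd_kernel (\<lambda>s t. \<Sum>m. \<kappa> m s t)"
proof (rule cnd_kernel_limit)
  fix m show "cnd_kernel (\<lambda>s t. \<Sum>i<m. \<kappa> i s t)"
  proof (induction m)
    case 0 show ?case by (simp add: cnd_kernel_def)
  next
    case (Suc m) then show ?case using cnd_kernel_add[OF Suc k] by simp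
  qed
next
  fix s t show "(\<lambda>m. \<Sum>i<m. \<kappa> i s t) \<longlonglongrightarrow> (\<Sum>m. \<kappa> m s t)" by (rule summable_LIMSEQ[OF sm])
qed

lemma cnd_kernel_square: "cnd_kernel (\<lambda>s t. (f s - f t)\<^sup>2)"
  unfolding cnd_kernel_def
proof (intro conjI allI impI)
  fix n :: nat and x :: "nat \<Rightarrow> 'a" and c :: "nat \<Rightarrow> real" assume z: "(\<Sum>i<n. c i) = 0"
  define a where "a = (\<lambda>i. f (x i))"
  have "(\<Sum>i<n. \<Sum>j<n. c i * c j * (a i - a j)\<^sup>2) =
    (\<Sum>i<n. \<Sum>j<n. c i * (a i)\<^sup>2 * c j + c i * (c j * (a j)\<^sup>2) - 2 * (c i * a i * (c j * a j)))"
    by (intro sum.cong refl) (simp add: power2_eq_square algebra_simps)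
  also have "\<dots> = (\<Sum>i<n. c i * (a i)\<^sup>2) * (\<Sum>i<n. c i) + (\<Sum>i<n. c i) * (\<Sum>i<n. c i * (a i)\<^sup>2) - 2 * ((\<Sum>i<n. c i * a i) * (\<Sum>i<n. c i * a i))"
    unfolding sum_product by (simp add: sum.distrib sum_subtractf sum_distrib_left)
  finally show "(\<Sum>i<n. \<Sum>j<n. c i * c j * (f (x i) - f (x j))\<^sup>2) \<le> 0" using z by (simp add: a_def)
qed (simp_all add: power2_commute)

section \<open>Fractional powers of kernels\<close>

lemma integrable_one_minus_exp_powr:
  fixes \<alpha> :: real assumes "0 < \<alpha>" "\<alpha> < 1"
  shows "integrable lborel (\<lambda>t. indicator {0<..} t * ((1 - exp (- t)) * t powr (- 1 - \<alpha>)))"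
proof (rule Bochner_Integration.integrable_bound)
  \<comment> \<open>Near 0 the bound 1 - exp(-t) <= t leaves t^(-\<alpha>), integrable because
    \<alpha> < 1; near infinity 1 - exp(-t) <= 1 leaves t^(-1-\<alpha>), integrable because \<alpha>
    > 0.\<close>
  have "(\<lambda>t. t powr (- \<alpha>)) absolutely_integrable_on {0..1}"
    by (subst absolutely_integrable_on_iff_nonneg) (use assms in \<open>auto intro!: integrable_on_powr_from_0\<close>)
  then have 1: "integrable lborel (\<lambda>t. indicator {0..1} t *\<^sub>R t powr (- \<alpha>))"
    by (subst (asm) set_integrable_def, subst (asm) integrable_completion) auto
  have "(\<lambda>t. t powr (- 1 - \<alpha>)) absolutely_integrable_on {1..}"
    using has_integral_powr_to_inf[of "- 1 - \<alpha>" 1] assms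
    by (subst absolutely_integrable_on_iff_nonneg) auto
  then have 2: "integrable lborel (\<lambda>t. indicator {1..} t *\<^sub>R t powr (- 1 - \<alpha>))"
    by (subst (asm) set_integrable_def, subst (asm) integrable_completion) auto
  show "integrable lborel (\<lambda>t. indicator {0..1} t *\<^sub>R t powr (- \<alpha>) + indicator {1..} t *\<^sub>R t powr (- 1 - \<alpha>))"
    by (intro Bochner_Integration.integrable_add 1 2)
  show "AE t in lborel. norm (indicator {0<..} t * ((1 - exp (- t)) * t powr (- 1 - \<alpha>))) \<le>
      norm (indicator {0..1} t *\<^sub>R t powr (- \<alpha>) + indicator {1..} t *\<^sub>R t powr (- 1 - \<alpha>) :: real)"
  proof (intro AE_I2)
    fix t :: real
    show "norm (indicator {0<..} t * ((1 - exp (- t)) * t powr (- 1 - \<alpha>))) \<le>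
      norm (indicator {0..1} t *\<^sub>R t powr (- \<alpha>) + indicator {1..} t *\<^sub>R t powr (- 1 - \<alpha>) :: real)"
    proof (cases "0 < t")
      case True
      have e: "1 - exp (- t) \<le> t" "0 \<le> 1 - exp (- t)" "1 - exp (- t) \<le> 1"
        using exp_ge_add_one_self[of "- t"] True by auto
      have "(1 - exp (- t)) * t powr (- 1 - \<alpha>) \<le> t * t powr (- 1 - \<alpha>)"
        by (rule mult_right_mono[OF e(1)]) simp
      also have "t * t powr (- 1 - \<alpha>) = t powr (- \<alpha>)" using True by (simp add: powr_mult_base)
      finally have "(1 - exp (- t)) * t powr (- 1 - \<alpha>) \<le> t powr (- \<alpha>)" .
      moreover have "(1 - exp (- t)) * t powr (- 1 - \<alpha>) \<le> 1 * t powr (- 1 - \<alpha>)"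
        by (rule mult_right_mono[OF e(3)]) simp
      moreover have "0 \<le> (1 - exp (- t)) * t powr (- 1 - \<alpha>)" using e(2) by simp
      ultimately show ?thesis using True by (auto simp: indicator_def intro: order_trans[OF _ exp_ge_zero])
    qed simp
  qed
qed measurable

text \<open>Up to a positive constant, l^\<alpha> is the integral over t > 0 of (1 - exp(-t l))
  t^(-1-\<alpha>), so the power is a mixture of the kernels 1 - exp(-t \<kappa>).\<close>

lemma cnd_kernel_powr:
  assumes k: "cnd_kernel \<kappa>" and \<alpha>: "0 < \<alpha>" "\<alpha> < 1"
  shows "cnd_kernel (\<lambda>s t. \<kappa> s t powr \<alpha>)"
proof -
  define g where "g = (\<lambda>t::real. indicator {0<..} t * ((1 - exp (- t)) * t powr (- 1 - \<alpha>)))"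
  define h where "h = (\<lambda>t l::real. indicator {0<..} t * (t powr (- 1 - \<alpha>) * (1 - exp (- t * l))))"
  have g: "integrable lborel g" unfolding g_def by (rule integrable_one_minus_exp_powr[OF \<alpha>])
  \<comment> \<open>The change of variable t to l t extracts the power of l;
    \<open>0 + l * t\<close> is the shape of an affine substitution for
    \<open>lborel\<close>.\<close>
  have hg: "h t l = l powr (1 + \<alpha>) * g (0 + l * t)" if "0 < l" for t l
  proof -
    have "l powr (1 + \<alpha>) * l powr (- 1 - \<alpha>) = 1"
      using that by (simp add: powr_add[symmetric])
    then show ?thesis
      using that by (auto simp: h_def g_def indicator_def powr_mult zero_less_mult_iff mult_ac)
  qed
  have h: "integrable lborel (\<lambda>t. h t l) \<and> (\<integral>t. h t l \<partial>lborel) = l powr \<alpha> * (\<integral>t. g t \<partial>lborel)" if "0 \<le> l" for l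
  proof (cases "l = 0")
    case True then show ?thesis by (simp add: h_def)
  next
    case False
    then have l: "0 < l" "l \<noteq> 0" using that by auto
    have i: "integrable lborel (\<lambda>t. g (0 + l * t))" using lborel_integrable_real_affine[OF g l(2), of 0] .
    have "(\<integral>t. g t \<partial>lborel) = l * (\<integral>t. g (0 + l * t) \<partial>lborel)"
      using lborel_integral_real_affine[OF l(2), of g 0] l by simp
    moreover have "l powr (1 + \<alpha>) = l powr \<alpha> * l" using l by (simp add: powr_add)
    ultimately show ?thesis using i unfolding hg[OF l(1)] by simp
  qed
  \<comment> \<open>The constant is to be divided out, so it must not vanish: g is positive on the
    unit interval, which is not a null set.\<close>
  have pos: "0 < (\<integral>t. g t \<partial>lborel)"
  proof -
    have nn: "0 \<le> g t" for t by (auto simp: g_def indicator_def)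
    have "(\<integral>t. g t \<partial>lborel) \<noteq> 0"
    proof
      assume "(\<integral>t. g t \<partial>lborel) = 0"
      then have "AE t in lborel. g t = 0"
        using integral_nonneg_eq_0_iff_AE[OF g] nn by simp
      then have "AE t in lborel. t \<notin> {0<..<1::real}"
        by eventually_elim (auto simp: g_def indicator_def)
      then have "{0<..<1::real} \<in> null_sets lborel"
        by (subst (asm) AE_iff_null_sets[symmetric]) auto
      then show False by (simp add: null_sets_def)
    qed
    then show ?thesis using Bochner_Integration.integral_nonneg[of lborel g] nn by (simp add: less_le)
  qed
  have "cnd_kernel (\<lambda>s t. \<integral>w. h w (\<kappa> s t) \<partial>lborel)"
  proof (rule cnd_kernel_integral)
    fix w :: real
    show "cnd_kernel (\<lambda>s t. h w (\<kappa> s t))"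
    proof (cases "0 < w")
      case True
      then show ?thesis
        using cnd_kernel_scale[OF cnd_kernel_one_minus_exp[OF k, of w], of "w powr (- 1 - \<alpha>)"] by (simp add: h_def)
    qed (simp add: h_def cnd_kernel_def)
  qed (use h cnd_kernel_nonneg[OF k] in blast)
  also have "(\<lambda>s t. \<integral>w. h w (\<kappa> s t) \<partial>lborel) = (\<lambda>s t. \<kappa> s t powr \<alpha> * (\<integral>t. g t \<partial>lborel))"
    using h cnd_kernel_nonneg[OF k] by blast
  finally have "cnd_kernel (\<lambda>s t. inverse (\<integral>t. g t \<partial>lborel) * (\<kappa> s t powr \<alpha> * (\<integral>t. g t \<partial>lborel)))"
    by (rule cnd_kernel_scale) (use pos in simp)
  then show ?thesis using pos by (simp add: field_simps)
qed

text \<open>Since |x|^p = (x^2)^(p/2), this is a fractional power of the squared distance on the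
  line; p <= 2 says that the exponent is at most 1.\<close>

lemma cnd_kernel_abs_powr:
  assumes "0 < p" "p \<le> 2"
  shows "cnd_kernel (\<lambda>s t. \<bar>f s - f t :: real\<bar> powr p)"
proof -
  have eq: "\<bar>x::real\<bar> powr p = (x\<^sup>2) powr (p / 2)" for x
  proof -
    have "x\<^sup>2 = \<bar>x\<bar> powr 2" by simp
    then show ?thesis by (simp only: powr_powr) simp
  qed
  show ?thesis
  proof (cases "p = 2")
    case True then show ?thesis using cnd_kernel_square[of f] by (simp add: eq)
  next
    case False
    then show ?thesis unfolding eq using cnd_kernel_powr[OF cnd_kernel_square[of f], of "p / 2"] assms by simp
  qed
qed

section \<open>A Bernstein function of logarithmic growth\<close>

definition slow :: "real \<Rightarrow> real" where
  "slow l = (\<Sum>n. 1 - exp (- ((1 / 2) ^ n) * l))"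

lemma slow_summable:
  fixes l :: real
  assumes "0 \<le> l" shows "summable (\<lambda>n. 1 - exp (- ((1 / 2) ^ n) * l))"
proof (rule summable_comparison_test')
  show "summable (\<lambda>n. (1 / 2 :: real) ^ n * l)" by (intro summable_mult2 summable_geometric) simp
  fix n :: nat assume "0 \<le> n"
  show "norm (1 - exp (- ((1 / 2) ^ n) * l)) \<le> (1 / 2) ^ n * l"
    using exp_ge_add_one_self[of "- ((1 / 2) ^ n) * l"] assms by simp
qed

lemma cnd_kernel_slow: "cnd_kernel \<kappa> \<Longrightarrow> cnd_kernel (\<lambda>s t. slow (\<kappa> s t))"
  unfolding slow_def
  by (rule cnd_kernel_suminf[of "\<lambda>m s t. 1 - exp (- ((1 / 2) ^ m) * \<kappa> s t)"])
    (rule cnd_kernel_one_minus_exp slow_summable; simp add: cnd_kernel_nonneg)+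

lemma slow_mono: "0 \<le> l \<Longrightarrow> l \<le> m \<Longrightarrow> slow l \<le> slow m"
  unfolding slow_def by (intro suminf_le slow_summable) auto

text \<open>Because the rates are dyadic, doubling l shifts the series by one place and exposes a
  single new term, which lies between 0 and 1.\<close>

lemma slow_double:
  assumes "0 \<le> l" shows "slow (2 * l) = slow l + (1 - exp (- 2 * l))"
proof -
  have "slow (2 * l) = (\<Sum>n. 1 - exp (- ((1 / 2) ^ Suc n) * (2 * l))) + (1 - exp (- 2 * l))"
    unfolding slow_def using suminf_split_head[OF slow_summable[of "2 * l"]] assms by simp
  then show ?thesis by (simp add: slow_def)
qed

text \<open>A factor C below 2^k is absorbed by k doublings, each costing at most 1, so L =
  k.\<close>

lemma slow_quasi_invariant:
  obtains L where "0 \<le> L" "\<And>l m. 0 \<le> l \<Longrightarrow> 0 \<le> m \<Longrightarrow> m \<le> C * l \<Longrightarrow> slow m \<le> slow l + L"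
proof -
  obtain k :: nat where k: "C < 2 ^ k" using real_arch_pow[of 2 C] by auto
  have pow: "slow (2 ^ j * l) \<le> slow l + real j" if "0 \<le> l" for j l
  proof (induction j)
    case (Suc j)
    have "slow (2 ^ Suc j * l) = slow (2 * (2 ^ j * l))" by (simp add: mult.assoc)
    also have "\<dots> \<le> slow (2 ^ j * l) + 1" using slow_double[of "2 ^ j * l"] that by simp
    finally show ?case using Suc by simp
  qed simp
  have "slow m \<le> slow l + real k" if "0 \<le> l" "0 \<le> m" "m \<le> C * l" for l m
  proof -
    have "C * l \<le> 2 ^ k * l" using k that by (intro mult_right_mono) auto
    then have "slow m \<le> slow (2 ^ k * l)" using that by (intro slow_mono) auto
    then show ?thesis using pow[OF that(1), of k] by simp
  qed
  then show thesis using that[of "real k"] by simp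
qed

text \<open>Along the powers of 2 every doubling gains at least 1 - exp(-1) >= 1/2. The statement
  bounds sublevel sets because properness is transferred in that form.\<close>

lemma slow_unbounded:
  obtains B where "\<And>l. 0 \<le> l \<Longrightarrow> slow l \<le> R \<Longrightarrow> l \<le> B"
proof -
  have low: "real j / 2 \<le> slow (2 ^ j)" for j
  proof (induction j)
    case 0 show ?case using slow_mono[of 0 1] by (simp add: slow_def)
  next
    case (Suc j)
    have "(1::real) \<le> 2 ^ j" by simp
    then have "(1::real) \<le> 2 * 2 ^ j" by linarith
    then have "exp (- (2 * 2 ^ j :: real)) \<le> exp (- 1)" by simp
    also have "exp (- 1 :: real) \<le> 1 / 2" using exp_ge_add_one_self[of 1] by (simp add: exp_minus field_simps)
    finally show ?case using Suc slow_double[of "2 ^ j"] by simp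
  qed
  obtain j :: nat where j: "2 * R < real j" using reals_Archimedean2 by blast
  have "l \<le> 2 ^ j" if "0 \<le> l" "slow l \<le> R" for l
  proof (rule ccontr)
    assume "\<not> l \<le> 2 ^ j"
    then have "slow (2 ^ j) \<le> slow l" by (intro slow_mono) auto
    then show False using low[of j] j that by simp
  qed
  then show thesis by (rule that)
qed

section \<open>Realising a conditionally negative definite kernel in \<open>L\<^sup>1\<close>\<close>

definition gauss_seq :: "(nat \<Rightarrow> real) measure" where
  "gauss_seq = PiM UNIV (\<lambda>_. density lborel std_normal_density)"

lemma sets_gauss_seq [measurable_cong]: "sets gauss_seq = sets (PiM UNIV (\<lambda>_. borel))"
  unfolding gauss_seq_def by (rule sets_PiM_cong) auto

lemma prob_space_gauss_seq: "prob_space gauss_seq"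
  unfolding gauss_seq_def by (intro prob_space_PiM prob_space_normal_density) simp

lemma distr_gauss_seq_component:
  "distr gauss_seq borel (\<lambda>x. x k) = density lborel std_normal_density"
proof -
  have "distr gauss_seq (density lborel std_normal_density) (\<lambda>x. x k) = density lborel std_normal_density"
    unfolding gauss_seq_def by (intro distr_PiM_component prob_space_normal_density) simp_all
  then show ?thesis by (simp cong: distr_cong)
qed

lemma distributed_gauss_seq_component:
  "distributed gauss_seq lborel (\<lambda>x. x k) std_normal_density"
proof -
  have "distr gauss_seq lborel (\<lambda>x. x k) = distr gauss_seq borel (\<lambda>x. x k)" by (rule distr_cong) simp_all
  then show ?thesis unfolding distributed_def by (simp add: distr_gauss_seq_component)
qed

lemma indep_gauss_seq: "prob_space.indep_vars gauss_seq (\<lambda>_. borel) (\<lambda>k x. x k) UNIV"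
proof -
  interpret prob_space gauss_seq by (rule prob_space_gauss_seq)
  have "distr gauss_seq (PiM UNIV (\<lambda>_. borel)) (\<lambda>x. \<lambda>i\<in>UNIV. x i) = distr gauss_seq gauss_seq (\<lambda>x. x)"
    by (rule distr_cong) (simp_all add: sets_gauss_seq restrict_def)
  also have "\<dots> = gauss_seq" by (rule distr_id)
  also have "\<dots> = PiM UNIV (\<lambda>k. distr gauss_seq borel (\<lambda>x. x k))"
    by (simp add: distr_gauss_seq_component) (simp add: gauss_seq_def)
  finally show ?thesis by (subst indep_vars_iff_distr_eq_PiM) auto
qed

text \<open>A combination of independent standard Gaussians is Gaussian with variance the sum of the
  squared coefficients, so its mean absolute value is a multiple of the Euclidean norm: l2 embeds in
  L1.\<close>

lemma gauss_seq_L1_norm: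
  fixes v :: "nat \<Rightarrow> real"
  shows "integrable gauss_seq (\<lambda>x. \<Sum>k<l. v k * x k)"
    and "(\<integral>x. \<bar>\<Sum>k<l. v k * x k\<bar> \<partial>gauss_seq) = sqrt (2 / pi) * sqrt (\<Sum>k<l. (v k)\<^sup>2)"
proof -
  interpret prob_space gauss_seq by (rule prob_space_gauss_seq)
  \<comment> \<open>Zero coefficients are discarded since a Gaussian of deviation 0 has no density;
    if nothing remains, both sides are 0.\<close>
  define I where "I = {k \<in> {..<l}. v k \<noteq> 0}"
  have fin: "finite I" by (simp add: I_def)
  have sumI: "(\<Sum>k<l. v k * x k) = (\<Sum>k\<in>I. v k * x k)" for x
    unfolding I_def by (rule sum.mono_neutral_right) auto
  have sumsqI: "(\<Sum>k<l. (v k)\<^sup>2) = (\<Sum>k\<in>I. (v k)\<^sup>2)"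
    unfolding I_def by (rule sum.mono_neutral_right) auto
  have "integrable gauss_seq (\<lambda>x. \<Sum>k\<in>I. v k * x k) \<and>
    (\<integral>x. \<bar>\<Sum>k\<in>I. v k * x k\<bar> \<partial>gauss_seq) = sqrt (2 / pi) * sqrt (\<Sum>k\<in>I. (v k)\<^sup>2)"
  proof (cases "I = {}")
    case True then show ?thesis by simp
  next
    case False
    define \<sigma> where "\<sigma> = sqrt (\<Sum>k\<in>I. (v k)\<^sup>2)"
    have "0 < (\<Sum>k\<in>I. (v k)\<^sup>2)" by (rule sum_pos[OF fin False]) (simp add: I_def)
    then have \<sigma>: "0 < \<sigma>" by (simp add: \<sigma>_def)
    have ind: "indep_vars (\<lambda>_. borel) (\<lambda>k x. v k * x k) I"
      by (rule indep_vars_compose2[OF indep_vars_subset[OF indep_gauss_seq subset_UNIV]]) measurable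
    have d: "distributed gauss_seq lborel (\<lambda>x. v k * x k) (normal_density 0 \<bar>v k\<bar>)" if "k \<in> I" for k
      using normal_density_affine[OF distributed_gauss_seq_component[of k], of "v k" 0] that by (simp add: I_def)
    have dS: "distributed gauss_seq lborel (\<lambda>x. \<Sum>k\<in>I. v k * x k) (normal_density 0 \<sigma>)"
      using sum_indep_normal[OF fin False ind, of "\<lambda>k. \<bar>v k\<bar>" "\<lambda>_. 0"] d by (simp add: I_def \<sigma>_def)
    have "(\<integral>x. \<bar>\<Sum>k\<in>I. v k * x k\<bar> \<partial>gauss_seq) = (\<integral>x. normal_density 0 \<sigma> x * \<bar>x\<bar> \<partial>lborel)"
      by (rule distributed_integral[OF dS, symmetric]) auto
    also have "\<dots> = \<sigma> * sqrt (2 / pi)"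
      using integral_normal_moment_abs_odd[OF \<sigma>, of 0 0] by simp
    finally have 1: "(\<integral>x. \<bar>\<Sum>k\<in>I. v k * x k\<bar> \<partial>gauss_seq) = sqrt (2 / pi) * \<sigma>" by simp
    have "integrable gauss_seq (\<lambda>x. \<Sum>k\<in>I. v k * x k)"
      using distributed_integrable[OF dS, of "\<lambda>x. x"] integrable_normal_moment[OF \<sigma>, of 0 1] by simp
    with 1 show ?thesis by (simp add: \<sigma>_def)
  qed
  then show "integrable gauss_seq (\<lambda>x. \<Sum>k<l. v k * x k)"
    "(\<integral>x. \<bar>\<Sum>k<l. v k * x k\<bar> \<partial>gauss_seq) = sqrt (2 / pi) * sqrt (\<Sum>k<l. (v k)\<^sup>2)"
    unfolding sumI sumsqI by auto
qed

text \<open>\<open>L\<^sup>1\<close> of this measure is the sum of an \<open>L\<^sup>1\<close> space containing \<open>\<ell>\<^sup>2\<close> (the slice \<open>0\<close>) and of \<open>\<ell>\<^sup>1\<close>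
  (the other slices).\<close>

lemma gauss_delta_L1_norm:
  fixes F :: "'i \<Rightarrow> nat \<Rightarrow> real" and \<nu> :: "'i \<Rightarrow> nat"
  assumes inj: "inj_on \<nu> T" and F0: "\<forall>t k. \<nu> t < k \<longrightarrow> F t k = 0"
    and \<Omega>_def: "\<Omega> = count_space (UNIV :: nat set) \<Otimes>\<^sub>M gauss_seq"
    and U_def: "U = (\<lambda>t z. if fst z = 0 then (\<Sum>k\<le>\<nu> t. F t k * snd z k) else of_bool (fst z = Suc (\<nu> t)) :: real)"
  shows "U t \<in> borel_measurable \<Omega>"
    and "finite S \<Longrightarrow> S \<subseteq> T \<Longrightarrow> (\<And>t. t \<in> S \<Longrightarrow> \<nu> t < l) \<Longrightarrow>
      (\<integral>\<^sup>+z. ennreal \<bar>\<Sum>t\<in>S. c t * U t z\<bar> \<partial>\<Omega>) =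
      ennreal (sqrt (2 / pi) * sqrt (\<Sum>k<l. (\<Sum>t\<in>S. c t * F t k)\<^sup>2) + (\<Sum>t\<in>S. \<bar>c t\<bar>))"
proof -
  interpret P: prob_space gauss_seq by (rule prob_space_gauss_seq)
  show meas [measurable]: "U t \<in> borel_measurable \<Omega>" for t
    unfolding U_def \<Omega>_def by measurable
  assume S: "finite S" "S \<subseteq> T" and l: "\<And>t. t \<in> S \<Longrightarrow> \<nu> t < l"
  define f where "f = (\<lambda>z. ennreal \<bar>\<Sum>t\<in>S. c t * U t z\<bar>)"
  define g where "g = (\<lambda>i. \<integral>\<^sup>+x. f (i, x) \<partial>gauss_seq)"
  have fm: "f \<in> borel_measurable (count_space UNIV \<Otimes>\<^sub>M gauss_seq)"
    unfolding f_def \<Omega>_def[symmetric] by measurable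
  have inS: "inj_on \<nu> S" using inj S(2) inj_on_subset by blast
  have "(\<integral>\<^sup>+z. f z \<partial>\<Omega>) = (\<integral>\<^sup>+i. g i \<partial>count_space UNIV)"
    unfolding \<Omega>_def g_def by (rule P.nn_integral_fst[OF fm, symmetric])
  \<comment> \<open>Slice 0 is Gaussian, and on slice \<open>Suc (\<nu> t)\<close>, of mass 1,
    \<open>U t\<close> is the only nonzero function with index in S. \<open>Suc\<close> keeps the
    number 0 free, and finitely many slices contribute.\<close>
  also have "\<dots> = (\<Sum>i\<in>insert 0 (Suc ` \<nu> ` S). g i)"
  proof (rule nn_integral_count_space')
    fix i :: nat assume "i \<notin> insert 0 (Suc ` \<nu> ` S)"
    then have "f (i, x) = 0" for x unfolding f_def U_def by (auto intro!: sum.neutral)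
    then show "g i = 0" by (simp add: g_def)
  qed (use S in auto)
  also have "\<dots> = g 0 + (\<Sum>t\<in>S. g (Suc (\<nu> t)))"
    using S inS by (subst sum.insert) (auto simp: sum.reindex image_image inj_on_def)
  also have "g (Suc (\<nu> t)) = ennreal \<bar>c t\<bar>" if t: "t \<in> S" for t
  proof -
    have "(\<Sum>s\<in>S. c s * U s (Suc (\<nu> t), x)) = (\<Sum>s\<in>S. if s = t then c t else 0)" for x
      using t inS by (intro sum.cong) (auto simp: U_def inj_on_def)
    then have "f (Suc (\<nu> t), x) = ennreal \<bar>c t\<bar>" for x using t S(1) by (simp add: f_def)
    then show ?thesis by (simp add: g_def P.emeasure_space_1)
  qed
  then have "(\<Sum>t\<in>S. g (Suc (\<nu> t))) = ennreal (\<Sum>t\<in>S. \<bar>c t\<bar>)" by (simp add: sum_ennreal)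
  also have "g 0 = ennreal (sqrt (2 / pi) * sqrt (\<Sum>k<l. (\<Sum>t\<in>S. c t * F t k)\<^sup>2))"
  proof -
    \<comment> \<open>Gram vectors of different lengths are padded with zeros to the common length
      \<open>l\<close>.\<close>
    have ext: "(\<Sum>k\<le>\<nu> t. F t k * x k) = (\<Sum>k<l. F t k * x k)" if "t \<in> S" for t and x :: "nat \<Rightarrow> real"
      using l[OF that] F0 by (intro sum.mono_neutral_left) auto
    have "(\<Sum>t\<in>S. c t * U t (0, x)) = (\<Sum>k<l. (\<Sum>t\<in>S. c t * F t k) * x k)" for x
    proof -
      have "(\<Sum>t\<in>S. c t * U t (0, x)) = (\<Sum>t\<in>S. \<Sum>k<l. c t * F t k * x k)"
        by (intro sum.cong refl) (simp add: U_def ext sum_distrib_left mult.assoc)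
      also have "\<dots> = (\<Sum>k<l. \<Sum>t\<in>S. c t * F t k * x k)" by (rule sum.swap)
      finally show ?thesis by (simp add: sum_distrib_right)
    qed
    then have "g 0 = (\<integral>\<^sup>+x. ennreal \<bar>\<Sum>k<l. (\<Sum>t\<in>S. c t * F t k) * x k\<bar> \<partial>gauss_seq)"
      by (simp add: g_def f_def)
    also have "\<dots> = ennreal (\<integral>x. \<bar>\<Sum>k<l. (\<Sum>t\<in>S. c t * F t k) * x k\<bar> \<partial>gauss_seq)"
      by (rule nn_integral_eq_integral) (simp_all add: gauss_seq_L1_norm)
    finally show ?thesis by (simp only: gauss_seq_L1_norm)
  qed
  finally show "(\<integral>\<^sup>+z. ennreal \<bar>\<Sum>t\<in>S. c t * U t z\<bar> \<partial>\<Omega>) =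
      ennreal (sqrt (2 / pi) * sqrt (\<Sum>k<l. (\<Sum>t\<in>S. c t * F t k)\<^sup>2) + (\<Sum>t\<in>S. \<bar>c t\<bar>))"
    unfolding f_def by (subst ennreal_plus) (auto intro!: sum_nonneg mult_nonneg_nonneg)
qed

text \<open>The point t is represented by its Gram vector, as a Gaussian variable, together with its
  own unit vector of l1. The condition that c sums to zero turns the positive kernel K back into
  -\<kappa>.\<close>

lemma cnd_kernel_L1_model:
  fixes \<kappa> :: "'i \<Rightarrow> 'i \<Rightarrow> real"
  assumes k: "cnd_kernel \<kappa>" and T: "countable T"
  obtains N :: "(nat \<Rightarrow> real) measure" and u where
    "\<And>t. t \<in> T \<Longrightarrow> integrable N (u t)"
    "\<And>S c. finite S \<Longrightarrow> S \<subseteq> T \<Longrightarrow> (\<Sum>t\<in>S. c t) = 0 \<Longrightarrow>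
      (\<integral>x. \<bar>\<Sum>t\<in>S. c t * u t x\<bar> \<partial>N) =
      sqrt (2 / pi) * sqrt (- (\<Sum>s\<in>S. \<Sum>t\<in>S. c s * c t * \<kappa> s t)) + (\<Sum>t\<in>S. \<bar>c t\<bar>)"
proof -
  fix e :: 'i
  define K where "K = (\<lambda>s t. \<kappa> s e + \<kappa> t e - \<kappa> s t)"
  define \<nu> where "\<nu> = to_nat_on T"
  have inj: "inj_on \<nu> T" unfolding \<nu>_def by (rule inj_on_to_nat_on[OF T])
  have from_\<nu>: "from_nat_into T (\<nu> t) = t" if "t \<in> T" for t
    unfolding \<nu>_def using T that by simp
  have "psd_kernel (\<lambda>m n. K (from_nat_into T m) (from_nat_into T n))"
    unfolding K_def by (rule psd_kernel_pullback[OF psd_kernel_of_cnd[OF k]])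
  then obtain L where L0: "\<And>m k. m < k \<Longrightarrow> L m k = 0"
    and L: "\<And>m n l. m < l \<Longrightarrow> K (from_nat_into T m) (from_nat_into T n) = (\<Sum>k<l. L m k * L n k)"
    by (rule psd_kernel_Gram) (rule that)
  define F where "F = (\<lambda>t k. L (\<nu> t) k)"
  define \<Omega> where "\<Omega> = count_space (UNIV :: nat set) \<Otimes>\<^sub>M gauss_seq"
  define U where "U = (\<lambda>t z. if fst z = 0 then (\<Sum>k\<le>\<nu> t. F t k * snd z k) else of_bool (fst z = Suc (\<nu> t)) :: real)"
  have F0: "\<forall>t k. \<nu> t < k \<longrightarrow> F t k = 0" by (simp add: F_def L0)
  note aux = gauss_delta_L1_norm[OF inj F0 \<Omega>_def U_def]
  have U [measurable]: "U t \<in> borel_measurable \<Omega>" for t by (rule aux(1))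
  \<comment> \<open>Pushing forward along the whole family of functions gives a measure on
    sequences; the functions become coordinates, and integrals of their combinations do not
    change.\<close>
  define N where "N = distr \<Omega> (PiM UNIV (\<lambda>_. borel)) (\<lambda>z n. U (from_nat_into T n) z)"
  define u where "u = (\<lambda>t x. x (\<nu> t) :: real)"
  have um [measurable]: "u t \<in> borel_measurable (PiM UNIV (\<lambda>_. borel))" for t
    unfolding u_def by measurable
  have Nm [measurable]: "(\<lambda>z n. U (from_nat_into T n) z) \<in> measurable \<Omega> (PiM UNIV (\<lambda>_. borel))"
    by (rule measurable_PiM_single') (auto intro: U)
  have uU: "u t (\<lambda>n. U (from_nat_into T n) z) = U t z" if "t \<in> T" for t z
    using from_\<nu>[OF that] by (simp add: u_def)
  have bound: "\<exists>l. \<forall>t\<in>S. \<nu> t < l" if "finite S" for S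
    using finite_nat_set_iff_bounded[of "\<nu> ` S"] that by simp
  show thesis
  proof (rule that)
    fix t assume t: "t \<in> T"
    have "(\<integral>\<^sup>+z. ennreal \<bar>U t z\<bar> \<partial>\<Omega>) < \<infinity>"
      using aux(2)[of "{t}" "Suc (\<nu> t)" "\<lambda>_. 1"] t by simp
    then have "integrable \<Omega> (U t)" by (intro integrableI_bounded) (auto intro: U)
    then show "integrable N (u t)" unfolding N_def by (subst integrable_distr_eq) (simp_all add: uU[OF t])
  next
    fix S and c :: "'i \<Rightarrow> real" assume S: "finite S" "S \<subseteq> T" and z: "(\<Sum>t\<in>S. c t) = 0"
    obtain l where l: "\<And>t. t \<in> S \<Longrightarrow> \<nu> t < l" using bound[OF S(1)] by blast
    have "(\<integral>x. \<bar>\<Sum>t\<in>S. c t * u t x\<bar> \<partial>N) = (\<integral>w. \<bar>\<Sum>t\<in>S. c t * u t (\<lambda>n. U (from_nat_into T n) w)\<bar> \<partial>\<Omega>)"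
      unfolding N_def by (rule integral_distr) measurable
    also have "\<dots> = (\<integral>w. \<bar>\<Sum>t\<in>S. c t * U t w\<bar> \<partial>\<Omega>)"
      using S(2) by (intro Bochner_Integration.integral_cong arg_cong[where f = abs] sum.cong) (auto simp: uU)
    also have "\<dots> = sqrt (2 / pi) * sqrt (\<Sum>k<l. (\<Sum>t\<in>S. c t * F t k)\<^sup>2) + (\<Sum>t\<in>S. \<bar>c t\<bar>)"
      using aux(2)[OF S l, of c] by (subst integral_eq_nn_integral)
        (simp_all add: sum_nonneg add_nonneg_nonneg del: ennreal_plus)
    also have "(\<Sum>k<l. (\<Sum>t\<in>S. c t * F t k)\<^sup>2) = (\<Sum>s\<in>S. \<Sum>t\<in>S. c s * c t * K s t)"
    proof -
      have "(\<Sum>k<l. (\<Sum>t\<in>S. c t * F t k)\<^sup>2) = (\<Sum>k<l. \<Sum>s\<in>S. \<Sum>t\<in>S. c s * F s k * (c t * F t k))"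
        unfolding power2_eq_square by (simp add: sum_product)
      also have "\<dots> = (\<Sum>s\<in>S. \<Sum>k<l. \<Sum>t\<in>S. c s * F s k * (c t * F t k))" by (rule sum.swap)
      also have "\<dots> = (\<Sum>s\<in>S. \<Sum>t\<in>S. \<Sum>k<l. c s * F s k * (c t * F t k))"
        by (intro sum.cong refl sum.swap)
      also have "\<dots> = (\<Sum>s\<in>S. \<Sum>t\<in>S. c s * c t * K s t)"
      proof (intro sum.cong refl)
        fix s t assume st: "s \<in> S" "t \<in> S"
        have "K s t = (\<Sum>k<l. F s k * F t k)"
          using L[OF l[OF st(1)], of "\<nu> t"] from_\<nu>[OF subsetD[OF S(2) st(1)]] from_\<nu>[OF subsetD[OF S(2) st(2)]]
          unfolding F_def by simp
        then show "(\<Sum>k<l. c s * F s k * (c t * F t k)) = c s * c t * K s t"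
          by (simp add: sum_distrib_left mult_ac)
      qed
      finally show ?thesis .
    qed
    \<comment> \<open>The terms of K involving e contain the factor
      \<open>\<Sum>t\<in>S. c t\<close>, so the choice of e does not matter.\<close>
    also have "(\<Sum>s\<in>S. \<Sum>t\<in>S. c s * c t * K s t) = - (\<Sum>s\<in>S. \<Sum>t\<in>S. c s * c t * \<kappa> s t)"
    proof -
      have "(\<Sum>s\<in>S. \<Sum>t\<in>S. c s * c t * K s t) =
        (\<Sum>s\<in>S. c s * \<kappa> s e) * (\<Sum>t\<in>S. c t) + (\<Sum>s\<in>S. c s) * (\<Sum>t\<in>S. c t * \<kappa> t e) - (\<Sum>s\<in>S. \<Sum>t\<in>S. c s * c t * \<kappa> s t)"
        unfolding K_def sum_product by (simp add: distrib_left right_diff_distrib sum.distrib sum_subtractf mult_ac)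
      then show ?thesis by (simp add: z)
    qed
    finally show "(\<integral>x. \<bar>\<Sum>t\<in>S. c t * u t x\<bar> \<partial>N) =
      sqrt (2 / pi) * sqrt (- (\<Sum>s\<in>S. \<Sum>t\<in>S. c s * c t * \<kappa> s t)) + (\<Sum>t\<in>S. \<bar>c t\<bar>)" .
  qed
qed

section \<open>Extending translations to a closed subspace of \<open>L\<^sup>1\<close>\<close>

lemma ae_class_in_L1: "integrable M f \<Longrightarrow> ae_class M f \<in> Lp_space M 1"
  unfolding Lp_space_def by auto

lemma L1_cases:
  assumes "w \<in> Lp_space M 1"
  obtains f where "integrable M f" "w = ae_class M f"
  using rep_Lp[OF assms] that[of "rep w"] by (simp add: integrable_abs_iff)

lemma integrable_rep_L1: "w \<in> Lp_space M 1 \<Longrightarrow> integrable M (rep w)"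
  using rep_Lp[of w M 1] by (simp add: integrable_abs_iff)

lemma L1_norm_ae_class: "integrable M f \<Longrightarrow> Lp_norm M 1 (ae_class M f) = (\<integral>x. \<bar>f x\<bar> \<partial>M)"
  by (simp add: Lp_norm_ae_class borel_measurable_integrable)

lemma L1_dist_ae_class:
  "integrable M f \<Longrightarrow> integrable M g \<Longrightarrow>
    Lp_dist M 1 (ae_class M f) (ae_class M g) = (\<integral>x. \<bar>f x - g x\<bar> \<partial>M)"
  unfolding Lp_dist_def by (simp add: Lp_diff_ae_class L1_norm_ae_class borel_measurable_integrable)

lemma Lp_add_L1:
  "integrable M f \<Longrightarrow> integrable M g \<Longrightarrow> Lp_add M (ae_class M f) (ae_class M g) = ae_class M (\<lambda>x. f x + g x)"
  by (simp add: Lp_add_ae_class borel_measurable_integrable)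

lemma Lp_scale_L1:
  "integrable M f \<Longrightarrow> Lp_scale M c (ae_class M f) = ae_class M (\<lambda>x. c * f x)"
  by (simp add: Lp_scale_ae_class borel_measurable_integrable)

lemma Lp_add_in_L1: "v \<in> Lp_space M 1 \<Longrightarrow> w \<in> Lp_space M 1 \<Longrightarrow> Lp_add M v w \<in> Lp_space M 1"
  by (elim L1_cases) (simp add: Lp_add_L1 ae_class_in_L1)

lemma Lp_scale_in_L1: "v \<in> Lp_space M 1 \<Longrightarrow> Lp_scale M c v \<in> Lp_space M 1"
  by (elim L1_cases) (simp add: Lp_scale_L1 ae_class_in_L1)

lemma L1_dist_add:
  assumes "v \<in> Lp_space M 1" "w \<in> Lp_space M 1" "v' \<in> Lp_space M 1" "w' \<in> Lp_space M 1"
  shows "Lp_dist M 1 (Lp_add M v w) (Lp_add M v' w') \<le> Lp_dist M 1 v v' + Lp_dist M 1 w w'"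
  using assms
proof (elim L1_cases)
  fix f g f' g'
  assume [simp]: "integrable M f" "integrable M g" "integrable M f'" "integrable M g'"
    and [simp]: "v = ae_class M f" "w = ae_class M g" "v' = ae_class M f'" "w' = ae_class M g'"
  have "(\<integral>x. \<bar>(f x + g x) - (f' x + g' x)\<bar> \<partial>M) \<le> (\<integral>x. \<bar>f x - f' x\<bar> + \<bar>g x - g' x\<bar> \<partial>M)"
    by (intro integral_mono) auto
  then show ?thesis by (simp add: Lp_add_L1 L1_dist_ae_class)
qed

lemma L1_dist_add_right:
  assumes "v \<in> Lp_space M 1" "v' \<in> Lp_space M 1" "w \<in> Lp_space M 1"
  shows "Lp_dist M 1 (Lp_add M v w) (Lp_add M v' w) = Lp_dist M 1 v v'"
  using assms by (elim L1_cases) (simp add: Lp_add_L1 L1_dist_ae_class)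

lemma L1_dist_scale:
  assumes "v \<in> Lp_space M 1" "w \<in> Lp_space M 1"
  shows "Lp_dist M 1 (Lp_scale M c v) (Lp_scale M c w) = \<bar>c\<bar> * Lp_dist M 1 v w"
  using assms
  by (elim L1_cases) (simp add: Lp_scale_L1 L1_dist_ae_class abs_mult flip: right_diff_distrib)

lemma L1_norm_eq_dist:
  assumes "v \<in> Lp_space M 1" shows "Lp_norm M 1 v = Lp_dist M 1 v (Lp_zero M)"
  using assms by (elim L1_cases) (simp add: Lp_zero_def L1_norm_ae_class L1_dist_ae_class)

lemma Lp_zero_in_L1: "Lp_zero M \<in> Lp_space M 1"
  unfolding Lp_zero_def by (simp add: ae_class_in_L1)

lemma mcomplete_L1: "Metric_space.mcomplete (Lp_space M 1) (Lp_dist M 1)"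
proof -
  interpret Metric_space "Lp_space M 1" "Lp_dist M 1" by (rule Metric_space_L1)
  show ?thesis unfolding mcomplete_def
  proof (intro allI impI)
    fix \<sigma> assume C: "MCauchy \<sigma>"
    define s where "s = (\<lambda>n. rep (\<sigma> n))"
    have \<sigma>L: "\<sigma> n \<in> Lp_space M 1" for n using C unfolding MCauchy_def by auto
    have s [simp]: "integrable M (s n)" for n using integrable_rep_L1[OF \<sigma>L] by (simp add: s_def)
    have [measurable]: "s n \<in> borel_measurable M" for n using s borel_measurable_integrable by blast
    have \<sigma>s: "\<sigma> n = ae_class M (s n)" for n using rep_Lp(3)[OF \<sigma>L] by (simp add: s_def)
    have cau: "\<exists>N. \<forall>i\<ge>N. \<forall>j\<ge>N. (\<integral>x. norm (s i x - s j x) \<partial>M) < e" if "0 < e" for e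
      using C that unfolding MCauchy_def by (simp add: \<sigma>s L1_dist_ae_class)
    obtain r where r: "strict_mono r" and ae: "AE x in M. Cauchy (\<lambda>i. s (r i) x)"
      using cauchy_L1_AE_cauchy_subseq[OF s cau] by metis
    define f where "f = (\<lambda>x. lim (\<lambda>i. s (r i) x))"
    have [measurable]: "f \<in> borel_measurable M" unfolding f_def by measurable
    have lim: "AE x in M. (\<lambda>i. s (r i) x) \<longlonglongrightarrow> f x"
      using ae by eventually_elim (simp add: f_def Cauchy_convergent_iff convergent_LIMSEQ_iff)
    \<comment> \<open>Fatou's lemma along the almost everywhere convergent subsequence carries the
      Cauchy bound over to f. It serves twice: for the integrability of f, and for convergence in
      norm.\<close>
    have fatou: "(\<integral>\<^sup>+x. ennreal \<bar>s i x - f x\<bar> \<partial>M) \<le> ennreal e"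
      if N: "\<forall>i\<ge>N. \<forall>j\<ge>N. (\<integral>x. norm (s i x - s j x) \<partial>M) < e" and i: "N \<le> i" for N e i
    proof -
      have "AE x in M. liminf (\<lambda>j. ennreal \<bar>s i x - s (r j) x\<bar>) = ennreal \<bar>s i x - f x\<bar>"
        using lim by eventually_elim (intro lim_imp_Liminf tendsto_intros, auto)
      then have "(\<integral>\<^sup>+x. ennreal \<bar>s i x - f x\<bar> \<partial>M) = (\<integral>\<^sup>+x. liminf (\<lambda>j. ennreal \<bar>s i x - s (r j) x\<bar>) \<partial>M)"
        by (intro nn_integral_cong_AE) auto
      also have "\<dots> \<le> liminf (\<lambda>j. \<integral>\<^sup>+x. ennreal \<bar>s i x - s (r j) x\<bar> \<partial>M)"
        by (rule nn_integral_liminf) measurable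
      also have "\<dots> \<le> liminf (\<lambda>j. ennreal e)"
      proof (rule Liminf_mono)
        show "\<forall>\<^sub>F j in sequentially. (\<integral>\<^sup>+x. ennreal \<bar>s i x - s (r j) x\<bar> \<partial>M) \<le> ennreal e"
          using eventually_ge_at_top[of N]
        proof eventually_elim
          case (elim j)
          then have "N \<le> r j" using seq_suble[OF r, of j] by simp
          then have "(\<integral>x. \<bar>s i x - s (r j) x\<bar> \<partial>M) < e" using N i by simp
          then show ?case by (subst nn_integral_eq_integral) (auto intro: ennreal_leI)
        qed
      qed
      finally show ?thesis by (simp add: Liminf_const)
    qed
    obtain N0 where N0: "\<forall>i\<ge>N0. \<forall>j\<ge>N0. (\<integral>x. norm (s i x - s j x) \<partial>M) < 1" using cau[of 1] by auto
    have "integrable M (\<lambda>x. s N0 x - f x)"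
      using le_less_trans[OF fatou[OF N0 order_refl], of \<infinity>] by (intro integrableI_bounded) auto
    from Bochner_Integration.integrable_diff[OF s[of N0] this] have f [simp]: "integrable M f" by simp
    have "limitin mtopology \<sigma> (ae_class M f) sequentially"
      unfolding limit_metric_sequentially
    proof (intro conjI allI impI)
      fix e :: real assume "0 < e"
      then obtain N where N: "\<forall>i\<ge>N. \<forall>j\<ge>N. (\<integral>x. norm (s i x - s j x) \<partial>M) < e / 2" using cau[of "e / 2"] by auto
      have "\<sigma> n \<in> Lp_space M 1 \<and> Lp_dist M 1 (\<sigma> n) (ae_class M f) < e" if "N \<le> n" for n
      proof -
        have "ennreal (\<integral>x. \<bar>s n x - f x\<bar> \<partial>M) \<le> ennreal (e / 2)"
          using fatou[OF N that] by (subst (asm) nn_integral_eq_integral) auto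
        then have "(\<integral>x. \<bar>s n x - f x\<bar> \<partial>M) \<le> e / 2" using \<open>0 < e\<close> by (simp add: ennreal_le_iff)
        then show ?thesis using \<sigma>L \<open>0 < e\<close> by (simp add: \<sigma>s L1_dist_ae_class)
      qed
      then show "\<exists>N. \<forall>n\<ge>N. \<sigma> n \<in> Lp_space M 1 \<and> Lp_dist M 1 (\<sigma> n) (ae_class M f) < e" by blast
    qed (simp add: ae_class_in_L1)
    then show "\<exists>x. limitin mtopology \<sigma> x sequentially" ..
  qed
qed

section \<open>Extension of Lipschitz maps to a closure\<close>

context Metric_space
begin

lemma closure_of_denseE:
  assumes "x \<in> mtopology closure_of D" "0 < e"
  obtains y where "y \<in> D" "d x y < e"
  using assms unfolding metric_closure_of by (auto simp: in_mball)

text \<open>An extension with some Lipschitz constant B exists by completeness, but B could depend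
  on the group element. Density recovers the original constant K, and also that the closure is
  mapped to itself.\<close>

lemma Lipschitz_self_map_extension:
  assumes comp: mcomplete and D: "D \<subseteq> M" and T: "T \<in> D \<rightarrow> D" and K: "0 \<le> K"
    and lip: "\<And>x y. x \<in> D \<Longrightarrow> y \<in> D \<Longrightarrow> d (T x) (T y) \<le> K * d x y"
  obtains h where "h \<in> mtopology closure_of D \<rightarrow> mtopology closure_of D"
    "\<And>x. x \<in> D \<Longrightarrow> h x = T x"
    "\<And>x y. x \<in> mtopology closure_of D \<Longrightarrow> y \<in> mtopology closure_of D \<Longrightarrow> d (h x) (h y) \<le> K * d x y"
proof -
  define E where "E = mtopology closure_of D"
  have DE: "D \<subseteq> E" unfolding E_def using D by (intro closure_of_subset) simp
  have EM: "E \<subseteq> M" unfolding E_def using closure_of_subset_topspace[of mtopology D] by simp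
  have "Lipschitz_continuous_map (submetric (metric (M, d)) D) (metric (M, d)) T"
    unfolding Lipschitz_continuous_map_def using D T lip by (auto intro!: exI[of _ K])
  then obtain h where h: "Lipschitz_continuous_map (submetric (metric (M, d)) E) (metric (M, d)) h"
    and hT: "\<And>x. x \<in> D \<Longrightarrow> h x = T x"
    using Lipschitz_continuous_map_extends_to_closure_of[of "metric (M, d)" "metric (M, d)" D T] comp
    unfolding E_def by auto
  obtain B where B: "0 < B" "\<And>x y. x \<in> E \<Longrightarrow> y \<in> E \<Longrightarrow> d (h x) (h y) \<le> B * d x y"
    and hM: "\<And>x. x \<in> E \<Longrightarrow> h x \<in> M"
    using h unfolding Lipschitz_continuous_map_pos by (simp add: Int_absorb2[OF EM] Pi_iff) metis
  have "d (h x) (h y) \<le> K * d x y" if x: "x \<in> E" and y: "y \<in> E" for x y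
  proof (rule field_le_epsilon)
    fix e :: real assume e: "0 < e"
    \<comment> \<open>Two approximations by points of D cost at most 2 (B + K) r in total: B r on
      the side of h and K r on the side of d, for each point.\<close>
    define r where "r = e / (2 * (B + K))"
    have BK: "0 < B + K" using B(1) K by simp
    then have r: "0 < r" using e by (simp add: r_def)
    obtain x' where x': "x' \<in> D" "d x x' < r" using closure_of_denseE[OF x[unfolded E_def] r] .
    obtain y' where y': "y' \<in> D" "d y y' < r" using closure_of_denseE[OF y[unfolded E_def] r] .
    note in_E = x y subsetD[OF DE x'(1)] subsetD[OF DE y'(1)]
    note in_M = subsetD[OF EM in_E(1)] subsetD[OF EM in_E(2)] subsetD[OF EM in_E(3)] subsetD[OF EM in_E(4)]
    have "d (h x) (h y) \<le> d (h x) (h x') + d (h x') (h y') + d (h y') (h y)"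
      using triangle[of "h x" "h x'" "h y"] triangle[of "h x'" "h y'" "h y"] hM in_E by fastforce
    also have "d (h x) (h x') \<le> B * r" using B(2)[OF in_E(1,3)] x'(2) B(1) mult_left_mono[of "d x x'" r B] by linarith
    also have "d (h y') (h y) \<le> B * r"
      using B(2)[OF in_E(4,2)] y'(2) B(1) mult_left_mono[of "d y y'" r B] commute[of y y'] by (metis (no_types) less_imp_le order_trans)
    also have "d (h x') (h y') \<le> K * d x' y'" using lip[OF x'(1) y'(1)] hT x'(1) y'(1) by simp
    also have "K * d x' y' \<le> K * (r + d x y + r)"
    proof (rule mult_left_mono[OF _ K])
      show "d x' y' \<le> r + d x y + r"
        using triangle[of x' x y'] triangle[of x y y'] in_M x'(2) y'(2) commute[of x x'] by fastforce
    qed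
    also have "B * r + K * (r + d x y + r) + B * r = K * d x y + 2 * (B + K) * r" by (simp add: algebra_simps)
    also have "2 * (B + K) * r = e" using BK by (simp add: r_def)
    finally show "d (h x) (h y) \<le> K * d x y + e" by simp
  qed
  moreover have "h x \<in> E" if x: "x \<in> E" for x
  proof -
    have "\<exists>y\<in>D. y \<in> mball (h x) r" if "0 < r" for r
    proof -
      have "0 < r / B" using that B(1) by simp
      then obtain x' where x': "x' \<in> D" "d x x' < r / B" using closure_of_denseE[OF x[unfolded E_def]] by blast
      have "d (h x) (h x') \<le> B * d x x'" using B(2) x x'(1) DE by blast
      also have "\<dots> < r" using x'(2) B(1) by (simp add: field_simps)
      finally have "h x' \<in> mball (h x) r" using hM x x'(1) DE by (auto simp: in_mball)
      then show ?thesis using hT[OF x'(1)] T x'(1) by (auto simp: Pi_iff)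
    qed
    then show ?thesis unfolding E_def metric_closure_of using hM[OF x] by auto
  qed
  ultimately show thesis using that[of h] hT unfolding E_def by auto
qed

end

text \<open>The bound \<open>quasi\<close> makes left translation of combinations well defined and
  Lipschitz on their classes, even if the functions \<open>u t\<close> satisfy linear relations. All
  identities are then carried to the closure by density.\<close>

lemma affine_action_of_quasi_invariant_L1_norm:
  fixes G :: "('g, 'r) monoid_scheme" and N :: "'b measure" and u :: "'g \<Rightarrow> 'b \<Rightarrow> real" and K :: real
  assumes G: "group G" and int: "\<And>t. t \<in> carrier G \<Longrightarrow> integrable N (u t)"
    and quasi: "\<And>S c g. finite S \<Longrightarrow> S \<subseteq> carrier G \<Longrightarrow> (\<Sum>t\<in>S. c t) = 0 \<Longrightarrow> g \<in> carrier G \<Longrightarrow>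
      (\<integral>x. \<bar>\<Sum>t\<in>S. c t * u (g \<otimes>\<^bsub>G\<^esub> t) x\<bar> \<partial>N) \<le> K * (\<integral>x. \<bar>\<Sum>t\<in>S. c t * u t x\<bar> \<partial>N)"
    and K: "1 \<le> K"
    and proper: "\<And>R. finite {g \<in> carrier G. (\<integral>x. \<bar>u g x - u \<one>\<^bsub>G\<^esub> x\<bar> \<partial>N) \<le> R}"
  shows "\<exists>E \<pi> b. closed_subspace_L1 N E \<and> affine_data_L1 G N E \<pi> b \<and>
     uniformly_Lipschitz_on G E (Lp_dist N 1) (affine_map_L1 N E \<pi> b) \<and>
     proper_on G E (Lp_dist N 1) (affine_map_L1 N E \<pi> b)"
proof -
  interpret group G by (rule G)
  interpret L1: Metric_space "Lp_space N 1" "Lp_dist N 1" by (rule Metric_space_L1)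
  let ?d = "Lp_dist N 1"
  \<comment> \<open>Formal combinations of total weight zero; the values of c off S are irrelevant.
    \<open>f g\<close> evaluates the same data after left translation by g.\<close>
  define Z where "Z = {(S, c :: 'g \<Rightarrow> real). finite S \<and> S \<subseteq> carrier G \<and> (\<Sum>t\<in>S. c t) = 0}"
  define f where "f = (\<lambda>g (S, c) x. \<Sum>t\<in>S. c t * u (g \<otimes>\<^bsub>G\<^esub> t) x)"
  define cl where "cl = (\<lambda>g z. ae_class N (f g z))"
  define D where "D = cl \<one>\<^bsub>G\<^esub> ` Z"
  define E where "E = L1.mtopology closure_of D"
  have f_int [simp]: "integrable N (f g z)" if "g \<in> carrier G" "z \<in> Z" for g z
    using that int by (auto simp: f_def Z_def split_def intro!: Bochner_Integration.integrable_sum integrable_mult_right)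
  have f_quasi: "(\<integral>x. \<bar>f g z x\<bar> \<partial>N) \<le> K * (\<integral>x. \<bar>f \<one>\<^bsub>G\<^esub> z x\<bar> \<partial>N)" if g: "g \<in> carrier G" and z: "z \<in> Z" for g z
  proof -
    obtain S c where Sc: "z = (S, c)" "finite S" "S \<subseteq> carrier G" "(\<Sum>t\<in>S. c t) = 0" using z by (auto simp: Z_def)
    have "f \<one>\<^bsub>G\<^esub> z x = (\<Sum>t\<in>S. c t * u t x)" for x
      unfolding f_def Sc(1) prod.case using Sc(3) by (intro sum.cong) auto
    then show ?thesis using quasi[OF Sc(2,3,4) g] by (simp add: f_def Sc(1))
  qed
  \<comment> \<open>The order of quantifiers matters: one datum works for every g, so linearity
    passes from formal combinations to all translations at once.\<close>
  have comb: "\<exists>z''\<in>Z. \<forall>g x. f g z'' x = a * f g z x + a' * f g z' x" if z: "z \<in> Z" "z' \<in> Z" for z z' a a'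
  proof -
    obtain S c S' c' where Sc: "z = (S, c)" "finite S" "S \<subseteq> carrier G" "(\<Sum>t\<in>S. c t) = 0"
      and Sc': "z' = (S', c')" "finite S'" "S' \<subseteq> carrier G" "(\<Sum>t\<in>S'. c' t) = 0"
      using z by (auto simp: Z_def)
    define w where "w = (\<lambda>t. a * (if t \<in> S then c t else 0) + a' * (if t \<in> S' then c' t else 0))"
    have fin: "finite (S \<union> S')" using Sc Sc' by simp
    have sumw: "(\<Sum>t\<in>S \<union> S'. w t * v t) = a * (\<Sum>t\<in>S. c t * v t) + a' * (\<Sum>t\<in>S'. c' t * v t)" for v
    proof -
      have "(\<Sum>t\<in>S \<union> S'. w t * v t) = a * (\<Sum>t\<in>S \<union> S'. if t \<in> S then c t * v t else 0) + a' * (\<Sum>t\<in>S \<union> S'. if t \<in> S' then c' t * v t else 0)"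
        unfolding sum_distrib_left sum.distrib[symmetric] by (intro sum.cong) (auto simp: w_def algebra_simps)
      also have "(\<Sum>t\<in>S \<union> S'. if t \<in> S then c t * v t else 0) = (\<Sum>t\<in>S. c t * v t)"
        using fin by (intro sum.mono_neutral_cong_right) auto
      also have "(\<Sum>t\<in>S \<union> S'. if t \<in> S' then c' t * v t else 0) = (\<Sum>t\<in>S'. c' t * v t)"
        using fin by (intro sum.mono_neutral_cong_right) auto
      finally show ?thesis .
    qed
    have "(S \<union> S', w) \<in> Z" using sumw[of "\<lambda>_. 1"] fin Sc Sc' by (simp add: Z_def)
    moreover have "\<forall>g x. f g (S \<union> S', w) x = a * f g z x + a' * f g z' x"
      by (simp add: f_def Sc(1) Sc'(1) sumw)
    ultimately show ?thesis by blast
  qed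
  have cl_L1: "cl g z \<in> Lp_space N 1" if "g \<in> carrier G" "z \<in> Z" for g z
    unfolding cl_def by (rule ae_class_in_L1[OF f_int[OF that]])
  have cl_lip: "?d (cl g z) (cl g z') \<le> K * ?d (cl \<one>\<^bsub>G\<^esub> z) (cl \<one>\<^bsub>G\<^esub> z')"
    if g: "g \<in> carrier G" and z: "z \<in> Z" "z' \<in> Z" for g z z'
  proof -
    obtain z'' where z'': "z'' \<in> Z" "\<And>g x. f g z'' x = 1 * f g z x + (- 1) * f g z' x" using comb[OF z, of 1 "- 1"] by blast
    show ?thesis using f_quasi[OF g z''(1)] g z by (simp add: cl_def L1_dist_ae_class z''(2))
  qed
  \<comment> \<open>Several data may have the same class, so a datum is chosen;
    \<open>cl_lip\<close> applied to two data at distance 0 shows that the choice is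
    immaterial.\<close>
  define T where "T = (\<lambda>g v. cl g (SOME z. z \<in> Z \<and> cl \<one>\<^bsub>G\<^esub> z = v))"
  have T_cl: "T g (cl \<one>\<^bsub>G\<^esub> z) = cl g z" if g: "g \<in> carrier G" and z: "z \<in> Z" for g z
  proof -
    define y where "y = (SOME y. y \<in> Z \<and> cl \<one>\<^bsub>G\<^esub> y = cl \<one>\<^bsub>G\<^esub> z)"
    have y: "y \<in> Z" "cl \<one>\<^bsub>G\<^esub> y = cl \<one>\<^bsub>G\<^esub> z"
      using someI[of "\<lambda>y. y \<in> Z \<and> cl \<one>\<^bsub>G\<^esub> y = cl \<one>\<^bsub>G\<^esub> z" z] z unfolding y_def by auto
    have "?d (cl g y) (cl g z) \<le> 0"
      using cl_lip[OF g y(1) z] y(2) L1.mdist_zero[OF cl_L1[OF one_closed z]] by simp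
    then have "cl g y = cl g z" using L1.zero[OF cl_L1[OF g y(1)] cl_L1[OF g z]] L1.nonneg[of "cl g y" "cl g z"] by linarith
    then show ?thesis by (simp add: T_def y_def)
  qed
  \<comment> \<open>Relabelling the support by g absorbs a translation into the data. For h the
    identity this keeps translates inside D; for general h it gives multiplicativity.\<close>
  have trans: "\<exists>z'\<in>Z. \<forall>h\<in>carrier G. cl h z' = cl (h \<otimes>\<^bsub>G\<^esub> g) z" if g: "g \<in> carrier G" and z: "z \<in> Z" for g z
  proof -
    obtain S c where Sc: "z = (S, c)" "finite S" "S \<subseteq> carrier G" "(\<Sum>t\<in>S. c t) = 0" using z by (auto simp: Z_def)
    let ?z = "((\<lambda>t. g \<otimes>\<^bsub>G\<^esub> t) ` S, \<lambda>t. c (inv\<^bsub>G\<^esub> g \<otimes>\<^bsub>G\<^esub> t))"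
    have inj: "inj_on (\<lambda>t. g \<otimes>\<^bsub>G\<^esub> t) S" by (rule inj_on_subset[OF inj_on_cmult[OF g] Sc(3)])
    have inv: "inv\<^bsub>G\<^esub> g \<otimes>\<^bsub>G\<^esub> (g \<otimes>\<^bsub>G\<^esub> t) = t" if "t \<in> S" for t
      using g Sc(3) that by (simp add: subset_iff m_assoc[symmetric])
    have "?z \<in> Z" using Sc g inv by (auto simp: Z_def sum.reindex[OF inj])
    moreover have "f h ?z x = f (h \<otimes>\<^bsub>G\<^esub> g) z x" if "h \<in> carrier G" for h x
      using g Sc(3) that inv unfolding f_def Sc(1) prod.case by (auto simp: sum.reindex[OF inj] subset_iff m_assoc intro!: sum.cong)
    ultimately show ?thesis unfolding cl_def by (intro bexI[of _ ?z]) (auto intro!: arg_cong[where f = "ae_class N"])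
  qed
  have D_L1: "D \<subseteq> Lp_space N 1" unfolding D_def using cl_L1 by auto
  have cl_D: "cl g z \<in> D" if g: "g \<in> carrier G" and z: "z \<in> Z" for g z
    using trans[OF that] g unfolding D_def by (metis imageI l_one one_closed)
  have T_D: "T g \<in> D \<rightarrow> D" if "g \<in> carrier G" for g using that T_cl cl_D by (auto simp: D_def)
  have T_lip: "?d (T g v) (T g w) \<le> K * ?d v w" if "g \<in> carrier G" "v \<in> D" "w \<in> D" for g v w
    using that cl_lip by (auto simp: D_def T_cl)
  have "\<exists>h. \<forall>g\<in>carrier G. h g \<in> E \<rightarrow> E \<and> (\<forall>v\<in>D. h g v = T g v) \<and>
    (\<forall>v\<in>E. \<forall>w\<in>E. ?d (h g v) (h g w) \<le> K * ?d v w)"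
  proof (rule bchoice, intro ballI)
    fix g assume g: "g \<in> carrier G"
    obtain h where "h \<in> E \<rightarrow> E" "\<And>v. v \<in> D \<Longrightarrow> h v = T g v"
      "\<And>v w. v \<in> E \<Longrightarrow> w \<in> E \<Longrightarrow> ?d (h v) (h w) \<le> K * ?d v w"
      using L1.Lipschitz_self_map_extension[OF mcomplete_L1 D_L1 T_D[OF g] _ T_lip[OF g]] K unfolding E_def by auto
    then show "\<exists>h. h \<in> E \<rightarrow> E \<and> (\<forall>v\<in>D. h v = T g v) \<and> (\<forall>v\<in>E. \<forall>w\<in>E. ?d (h v) (h w) \<le> K * ?d v w)" by blast
  qed
  then obtain h where h: "\<forall>g\<in>carrier G. h g \<in> E \<rightarrow> E \<and> (\<forall>v\<in>D. h g v = T g v) \<and>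
    (\<forall>v\<in>E. \<forall>w\<in>E. ?d (h g v) (h g w) \<le> K * ?d v w)" ..
  have hE: "h g v \<in> E" if "g \<in> carrier G" "v \<in> E" for g v
    using bspec[OF h that(1)] that(2) by (auto simp: Pi_iff)
  have hT: "h g v = T g v" if "g \<in> carrier G" "v \<in> D" for g v
    using bspec[OF h that(1)] that(2) by blast
  have h_lip: "?d (h g v) (h g w) \<le> K * ?d v w" if "g \<in> carrier G" "v \<in> E" "w \<in> E" for g v w
    using bspec[OF h that(1)] that(2,3) by blast
  have h_cl: "h g (cl \<one>\<^bsub>G\<^esub> z) = cl g z" if "g \<in> carrier G" "z \<in> Z" for g z
    using that hT T_cl by (simp add: D_def)
  have DE: "D \<subseteq> E" unfolding E_def using D_L1 by (intro closure_of_subset) simp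
  have E_L1: "v \<in> Lp_space N 1" if "v \<in> E" for v
    using that closure_of_subset_topspace[of L1.mtopology D] unfolding E_def by auto
  have dense: "\<exists>z\<in>Z. ?d v (cl \<one>\<^bsub>G\<^esub> z) < e" if "v \<in> E" "0 < e" for v e
    using L1.closure_of_denseE[of v D e] that unfolding E_def D_def by blast
  have E_I: "v \<in> E" if v: "v \<in> Lp_space N 1" and near: "\<And>e. 0 < e \<Longrightarrow> \<exists>w\<in>D. ?d v w < e" for v
    unfolding E_def L1.metric_closure_of using v near D_L1 by (fastforce simp: L1.in_mball)
  have add_cl: "\<exists>z''\<in>Z. \<forall>g\<in>carrier G. Lp_add N (cl g z) (cl g z') = cl g z''" if z: "z \<in> Z" "z' \<in> Z" for z z'
  proof -
    obtain z'' where z'': "z'' \<in> Z" "\<And>g x. f g z'' x = 1 * f g z x + 1 * f g z' x" using comb[OF z, of 1 1] by blast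
    have "Lp_add N (cl g z) (cl g z') = cl g z''" if "g \<in> carrier G" for g
      using that z z'' by (auto simp: cl_def Lp_add_L1 intro!: arg_cong[where f = "ae_class N"])
    with z''(1) show ?thesis by blast
  qed
  have scale_cl: "\<exists>z''\<in>Z. \<forall>g\<in>carrier G. Lp_scale N a (cl g z) = cl g z''" if z: "z \<in> Z" for z a
  proof -
    obtain z'' where z'': "z'' \<in> Z" "\<And>g x. f g z'' x = a * f g z x + 0 * f g z x" using comb[OF z z, of a 0] by blast
    have "Lp_scale N a (cl g z) = cl g z''" if "g \<in> carrier G" for g
      using that z z'' by (auto simp: cl_def Lp_scale_L1 intro!: arg_cong[where f = "ae_class N"])
    with z''(1) show ?thesis by blast
  qed
  have E_add: "Lp_add N v w \<in> E" if v: "v \<in> E" and w: "w \<in> E" for v w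
  proof (rule E_I)
    show "Lp_add N v w \<in> Lp_space N 1" using v w E_L1 by (simp add: Lp_add_in_L1)
    fix e :: real assume "0 < e"
    then obtain z z' where z: "z \<in> Z" "?d v (cl \<one>\<^bsub>G\<^esub> z) < e / 2" and z': "z' \<in> Z" "?d w (cl \<one>\<^bsub>G\<^esub> z') < e / 2"
      using dense[OF v, of "e / 2"] dense[OF w, of "e / 2"] by auto
    obtain z'' where "z'' \<in> Z" "Lp_add N (cl \<one>\<^bsub>G\<^esub> z) (cl \<one>\<^bsub>G\<^esub> z') = cl \<one>\<^bsub>G\<^esub> z''" using add_cl[OF z(1) z'(1)] by auto
    moreover have "?d (Lp_add N v w) (Lp_add N (cl \<one>\<^bsub>G\<^esub> z) (cl \<one>\<^bsub>G\<^esub> z')) < e"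
      using L1_dist_add[OF E_L1[OF v] E_L1[OF w] cl_L1[OF one_closed z(1)] cl_L1[OF one_closed z'(1)]] z(2) z'(2) by simp
    ultimately show "\<exists>y\<in>D. ?d (Lp_add N v w) y < e" unfolding D_def by auto
  qed
  have E_scale: "Lp_scale N a v \<in> E" if v: "v \<in> E" for v a
  proof (rule E_I)
    show "Lp_scale N a v \<in> Lp_space N 1" using v E_L1 by (simp add: Lp_scale_in_L1)
    fix e :: real assume e: "0 < e"
    obtain z where z: "z \<in> Z" "?d v (cl \<one>\<^bsub>G\<^esub> z) < e / (\<bar>a\<bar> + 1)" using dense[OF v, of "e / (\<bar>a\<bar> + 1)"] e by auto
    obtain z'' where "z'' \<in> Z" "Lp_scale N a (cl \<one>\<^bsub>G\<^esub> z) = cl \<one>\<^bsub>G\<^esub> z''" using scale_cl[OF z(1), of a] one_closed by blast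
    moreover have "?d (Lp_scale N a v) (Lp_scale N a (cl \<one>\<^bsub>G\<^esub> z)) < e"
    proof -
      have "\<bar>a\<bar> * ?d v (cl \<one>\<^bsub>G\<^esub> z) \<le> \<bar>a\<bar> * (e / (\<bar>a\<bar> + 1))" using z(2) by (intro mult_left_mono) auto
      also have "\<dots> < e" using e by (simp add: field_simps)
      finally show ?thesis using L1_dist_scale[OF E_L1[OF v] cl_L1[OF one_closed z(1)]] by simp
    qed
    ultimately show "\<exists>y\<in>D. ?d (Lp_scale N a v) y < e" unfolding D_def by auto
  qed
  have empty_Z: "({}, \<lambda>_. 0) \<in> Z" by (simp add: Z_def)
  have cl_empty: "cl g ({}, \<lambda>_. 0) = Lp_zero N" for g by (simp add: cl_def f_def Lp_zero_def)
  have zero_E: "Lp_zero N \<in> E" using cl_D[OF one_closed empty_Z] DE by (auto simp: cl_empty)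
  have h_zero: "h g (Lp_zero N) = Lp_zero N" if "g \<in> carrier G" for g using h_cl[OF that empty_Z] by (simp add: cl_empty)
  have E_sub: "closed_subspace_L1 N E"
    unfolding closed_subspace_L1_def using E_L1 zero_E E_add E_scale by (auto simp: E_def)
  \<comment> \<open>The identities for h below compare both sides with an element of D coming from
    e-close approximations. Each multiple of e used later adds up the Lipschitz errors of the two
    comparisons.\<close>
  have eqI: "v = w" if "v \<in> Lp_space N 1" "w \<in> Lp_space N 1" and le: "\<And>e. 0 < e \<Longrightarrow> ?d v w \<le> B * e" for v w B
  proof -
    have "?d v w \<le> 0"
    proof (rule field_le_epsilon)
      fix e :: real assume e: "0 < e"
      have "?d v w \<le> B * (e / (\<bar>B\<bar> + 1))" by (rule le) (use e in simp)
      also have "\<dots> \<le> \<bar>B\<bar> * (e / (\<bar>B\<bar> + 1))" using e by (intro mult_right_mono) auto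
      also have "\<dots> \<le> e" using e by (simp add: field_simps)
      finally show "?d v w \<le> 0 + e" by simp
    qed
    then show ?thesis using L1.zero[OF that(1,2)] L1.nonneg[of v w] by linarith
  qed
  have clE: "cl g z \<in> E" if "g \<in> carrier G" "z \<in> Z" for g z using cl_D[OF that] DE by blast
  have near: "?d (h g v) (cl g z) \<le> K * e"
    if g: "g \<in> carrier G" and v: "v \<in> E" and z: "z \<in> Z" and le: "?d v (cl \<one>\<^bsub>G\<^esub> z) < e" for g v z e
  proof -
    have "?d (h g v) (h g (cl \<one>\<^bsub>G\<^esub> z)) \<le> K * ?d v (cl \<one>\<^bsub>G\<^esub> z)" by (rule h_lip[OF g v clE[OF one_closed z]])
    also have "\<dots> \<le> K * e" using le K by (intro mult_left_mono) auto
    finally show ?thesis by (simp add: h_cl[OF g z])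
  qed
  have h_add: "h g (Lp_add N v w) = Lp_add N (h g v) (h g w)" if g: "g \<in> carrier G" and v: "v \<in> E" and w: "w \<in> E" for g v w
  proof (rule eqI[of _ _ "4 * K"])
    note inE = E_add[OF v w] hE[OF g E_add[OF v w]] hE[OF g v] hE[OF g w]
    show "h g (Lp_add N v w) \<in> Lp_space N 1" "Lp_add N (h g v) (h g w) \<in> Lp_space N 1"
      by (rule E_L1[OF inE(2)], rule Lp_add_in_L1[OF E_L1[OF inE(3)] E_L1[OF inE(4)]])
    fix e :: real assume "0 < e"
    then obtain z z' where z: "z \<in> Z" "?d v (cl \<one>\<^bsub>G\<^esub> z) < e" and z': "z' \<in> Z" "?d w (cl \<one>\<^bsub>G\<^esub> z') < e"
      using dense[OF v, of e] dense[OF w, of e] by auto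
    obtain z'' where z'': "z'' \<in> Z" "\<And>k. k \<in> carrier G \<Longrightarrow> Lp_add N (cl k z) (cl k z') = cl k z''" using add_cl[OF z(1) z'(1)] by blast
    have "?d (h g (Lp_add N v w)) (h g (cl \<one>\<^bsub>G\<^esub> z'')) \<le> K * ?d (Lp_add N v w) (cl \<one>\<^bsub>G\<^esub> z'')"
      using h_lip[OF g inE(1) clE[OF one_closed z''(1)]] .
    also have "\<dots> \<le> K * (2 * e)"
      using L1_dist_add[OF E_L1[OF v] E_L1[OF w] cl_L1[OF one_closed z(1)] cl_L1[OF one_closed z'(1)]] z(2) z'(2) K
      by (intro mult_left_mono) (auto simp: z''(2))
    finally have 1: "?d (h g (Lp_add N v w)) (cl g z'') \<le> K * (2 * e)" by (simp add: h_cl[OF g z''(1)])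
    have "?d (h g v) (cl g z) \<le> K * e" by (rule near[OF g v z])
    moreover have "?d (h g w) (cl g z') \<le> K * e" by (rule near[OF g w z'])
    ultimately have 2: "?d (Lp_add N (h g v) (h g w)) (cl g z'') \<le> K * e + K * e"
      using L1_dist_add[OF E_L1[OF inE(3)] E_L1[OF inE(4)] cl_L1[OF g z(1)] cl_L1[OF g z'(1)]] by (simp add: z''(2)[OF g])
    show "?d (h g (Lp_add N v w)) (Lp_add N (h g v) (h g w)) \<le> 4 * K * e"
      using L1.triangle[OF E_L1[OF inE(2)] cl_L1[OF g z''(1)] Lp_add_in_L1[OF E_L1[OF inE(3)] E_L1[OF inE(4)]]] 1 2
        L1.commute[of "cl g z''"] by simp
  qed
  have h_scale: "h g (Lp_scale N a v) = Lp_scale N a (h g v)" if g: "g \<in> carrier G" and v: "v \<in> E" for g v a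
  proof (rule eqI[of _ _ "2 * K * \<bar>a\<bar>"])
    note inE = E_scale[OF v, of a] hE[OF g E_scale[OF v, of a]] hE[OF g v]
    show "h g (Lp_scale N a v) \<in> Lp_space N 1" "Lp_scale N a (h g v) \<in> Lp_space N 1"
      by (rule E_L1[OF inE(2)], rule Lp_scale_in_L1[OF E_L1[OF inE(3)]])
    fix e :: real assume "0 < e"
    then obtain z where z: "z \<in> Z" "?d v (cl \<one>\<^bsub>G\<^esub> z) < e" using dense[OF v, of e] by auto
    obtain z'' where z'': "z'' \<in> Z" "\<And>k. k \<in> carrier G \<Longrightarrow> Lp_scale N a (cl k z) = cl k z''" using scale_cl[OF z(1), of a] by blast
    have ae: "\<bar>a\<bar> * ?d v (cl \<one>\<^bsub>G\<^esub> z) \<le> \<bar>a\<bar> * e" using z(2) by (intro mult_left_mono) auto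
    have "?d (h g (Lp_scale N a v)) (h g (cl \<one>\<^bsub>G\<^esub> z'')) \<le> K * ?d (Lp_scale N a v) (cl \<one>\<^bsub>G\<^esub> z'')"
      using h_lip[OF g inE(1) clE[OF one_closed z''(1)]] .
    also have "\<dots> \<le> K * (\<bar>a\<bar> * e)"
      using L1_dist_scale[OF E_L1[OF v] cl_L1[OF one_closed z(1)], of a] ae K
      by (intro mult_left_mono) (auto simp: z''(2))
    finally have 1: "?d (h g (Lp_scale N a v)) (cl g z'') \<le> K * (\<bar>a\<bar> * e)" by (simp add: h_cl[OF g z''(1)])
    have "?d (h g v) (cl g z) \<le> K * e" by (rule near[OF g v z])
    then have "\<bar>a\<bar> * ?d (h g v) (cl g z) \<le> \<bar>a\<bar> * (K * e)" by (intro mult_left_mono) auto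
    then have 2: "?d (Lp_scale N a (h g v)) (cl g z'') \<le> \<bar>a\<bar> * (K * e)"
      using L1_dist_scale[OF E_L1[OF inE(3)] cl_L1[OF g z(1)], of a] by (simp add: z''(2)[OF g])
    show "?d (h g (Lp_scale N a v)) (Lp_scale N a (h g v)) \<le> 2 * K * \<bar>a\<bar> * e"
      using L1.triangle[OF E_L1[OF inE(2)] cl_L1[OF g z''(1)] Lp_scale_in_L1[OF E_L1[OF inE(3)]], of a] 1 2
        L1.commute[of "cl g z''"] by (simp add: mult_ac)
  qed
  have h_mult: "h (g \<otimes>\<^bsub>G\<^esub> k) v = h g (h k v)" if g: "g \<in> carrier G" and k: "k \<in> carrier G" and v: "v \<in> E" for g k v
  proof (rule eqI[of _ _ "K + K * K"])
    have gk: "g \<otimes>\<^bsub>G\<^esub> k \<in> carrier G" using g k by simp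
    note inE = hE[OF gk v] hE[OF k v] hE[OF g hE[OF k v]]
    show "h (g \<otimes>\<^bsub>G\<^esub> k) v \<in> Lp_space N 1" "h g (h k v) \<in> Lp_space N 1"
      by (rule E_L1[OF inE(1)], rule E_L1[OF inE(3)])
    fix e :: real assume "0 < e"
    then obtain z where z: "z \<in> Z" "?d v (cl \<one>\<^bsub>G\<^esub> z) < e" using dense[OF v, of e] by auto
    obtain z' where z': "z' \<in> Z" "\<And>m. m \<in> carrier G \<Longrightarrow> cl m z' = cl (m \<otimes>\<^bsub>G\<^esub> k) z" using trans[OF k z(1)] by blast
    have le: "?d (h m v) (cl m z) \<le> K * e" if "m \<in> carrier G" for m by (rule near[OF that v z])
    have e1: "h g (cl k z) = cl (g \<otimes>\<^bsub>G\<^esub> k) z"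
      using h_cl[OF g z'(1)] z'(2)[OF one_closed] z'(2)[OF g] k by simp
    have "?d (h g (h k v)) (h g (cl k z)) \<le> K * ?d (h k v) (cl k z)" by (rule h_lip[OF g inE(2) clE[OF k z(1)]])
    also have "\<dots> \<le> K * (K * e)" using le[OF k] K by (intro mult_left_mono) auto
    finally have "?d (h g (h k v)) (cl (g \<otimes>\<^bsub>G\<^esub> k) z) \<le> K * (K * e)" by (simp add: e1)
    then show "?d (h (g \<otimes>\<^bsub>G\<^esub> k) v) (h g (h k v)) \<le> (K + K * K) * e"
      using L1.triangle[OF E_L1[OF inE(1)] cl_L1[OF gk z(1)] E_L1[OF inE(3)]] le[OF gk]
        L1.commute[of "cl (g \<otimes>\<^bsub>G\<^esub> k) z"] by (simp add: algebra_simps)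
  qed
  have h_one: "h \<one>\<^bsub>G\<^esub> v = v" if v: "v \<in> E" for v
  proof (rule eqI[of _ _ "K + 1"])
    note inE = hE[OF one_closed v]
    show "h \<one>\<^bsub>G\<^esub> v \<in> Lp_space N 1" "v \<in> Lp_space N 1"
      by (rule E_L1[OF inE], rule E_L1[OF v])
    fix e :: real assume "0 < e"
    then obtain z where z: "z \<in> Z" "?d v (cl \<one>\<^bsub>G\<^esub> z) < e" using dense[OF v, of e] by auto
    have "?d (h \<one>\<^bsub>G\<^esub> v) (cl \<one>\<^bsub>G\<^esub> z) \<le> K * e" by (rule near[OF one_closed v z])
    then show "?d (h \<one>\<^bsub>G\<^esub> v) v \<le> (K + 1) * e"
      using L1.triangle[OF E_L1[OF inE] cl_L1[OF one_closed z(1)] E_L1[OF v]] z(2)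
        L1.commute[of "cl \<one>\<^bsub>G\<^esub> z"] by (simp add: algebra_simps)
  qed
  \<comment> \<open>Elements of \<open>Bij E\<close> are extensional, hence the restriction.\<close>
  define \<pi> where "\<pi> = (\<lambda>g. restrict (h g) E)"
  define b where "b = (\<lambda>g. ae_class N (\<lambda>x. u g x - u \<one>\<^bsub>G\<^esub> x))"
  have h_inv: "h (inv\<^bsub>G\<^esub> g) (h g v) = v" "h g (h (inv\<^bsub>G\<^esub> g) v) = v" if "g \<in> carrier G" "v \<in> E" for g v
    using that h_mult[of "inv\<^bsub>G\<^esub> g" g v] h_mult[of g "inv\<^bsub>G\<^esub> g" v] h_one by auto
  have \<pi>_bij: "bij_betw (\<pi> g) E E" if g: "g \<in> carrier G" for g
    by (rule bij_betw_byWitness[where f' = "h (inv\<^bsub>G\<^esub> g)"]) (use g h_inv hE in \<open>auto simp: \<pi>_def\<close>)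
  have \<pi>_Bij: "\<pi> g \<in> Bij E" if "g \<in> carrier G" for g
    using \<pi>_bij[OF that] by (simp add: Bij_def \<pi>_def)
  have \<pi>_inv: "inv_into E (\<pi> g) v = h (inv\<^bsub>G\<^esub> g) v" if g: "g \<in> carrier G" and v: "v \<in> E" for g v
    using inv_into_f_eq[OF bij_betw_imp_inj_on[OF \<pi>_bij[OF g]], of "h (inv\<^bsub>G\<^esub> g) v" v] g v hE h_inv by (simp add: \<pi>_def)
  \<comment> \<open>Stated for any t agreeing with \<open>h g\<close> on E, so that it covers both
    \<open>\<pi> g\<close> and its inverse, which agrees with h at the inverse element.\<close>
  have lin: "bounded_linear_L1 N E t" if g: "g \<in> carrier G" and t: "\<And>v. v \<in> E \<Longrightarrow> t v = h g v" for g t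
    unfolding bounded_linear_L1_def
  proof (intro conjI ballI allI exI[of _ K])
    show "t \<in> E \<rightarrow> E" using t hE[OF g] by auto
    fix v assume v: "v \<in> E"
    show "t (Lp_scale N c v) = Lp_scale N c (t v)" for c using t v E_scale h_scale g by simp
    show "t (Lp_add N v w) = Lp_add N (t v) (t w)" if "w \<in> E" for w using t v that E_add h_add g by simp
    show "Lp_norm N 1 (t v) \<le> K * Lp_norm N 1 v"
      using h_lip[OF g v zero_E] h_zero[OF g] E_L1[OF v] E_L1[OF hE[OF g v]] t[OF v] by (simp add: L1_norm_eq_dist)
  qed
  have \<pi>_GL: "\<pi> g \<in> carrier (GL_L1 N E)" if g: "g \<in> carrier G" for g
    using \<pi>_Bij[OF g] lin[OF g, of "\<pi> g"] lin[of "inv\<^bsub>G\<^esub> g" "inv_into E (\<pi> g)"] \<pi>_inv[OF g] g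
    by (simp add: GL_L1_def \<pi>_def)
  have \<pi>_hom: "\<pi> \<in> hom G (GL_L1 N E)"
  proof (rule homI)
    fix g k assume g: "g \<in> carrier G" and k: "k \<in> carrier G"
    show "\<pi> g \<in> carrier (GL_L1 N E)" by (rule \<pi>_GL[OF g])
    have "\<pi> (g \<otimes>\<^bsub>G\<^esub> k) = compose E (\<pi> g) (\<pi> k)"
      unfolding \<pi>_def compose_def using g k hE h_mult by (auto simp: restrict_def fun_eq_iff)
    then show "\<pi> (g \<otimes>\<^bsub>G\<^esub> k) = \<pi> g \<otimes>\<^bsub>GL_L1 N E\<^esub> \<pi> k"
      using \<pi>_Bij[OF g] \<pi>_Bij[OF k] by (simp add: GL_L1_def BijGroup_def)
  qed
  have b_cl: "\<exists>z\<in>Z. \<forall>k\<in>carrier G. cl k z = ae_class N (\<lambda>x. u (k \<otimes>\<^bsub>G\<^esub> g) x - u k x)" if g: "g \<in> carrier G" for g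
  proof -
    \<comment> \<open>If g is the identity, the support collapses to one point and the two
      indicators cancel, so this datum also covers that case.\<close>
    let ?z = "({g, \<one>\<^bsub>G\<^esub>}, \<lambda>t. of_bool (t = g) - of_bool (t = \<one>\<^bsub>G\<^esub>) :: real)"
    have "?z \<in> Z" using g by (cases "g = \<one>\<^bsub>G\<^esub>") (auto simp: Z_def)
    moreover have "f k ?z = (\<lambda>x. u (k \<otimes>\<^bsub>G\<^esub> g) x - u k x)" if "k \<in> carrier G" for k
      using g that by (cases "g = \<one>\<^bsub>G\<^esub>") (auto simp: f_def)
    ultimately show ?thesis by (intro bexI[of _ ?z]) (auto simp: cl_def)
  qed
  have b_E: "b g \<in> E" if g: "g \<in> carrier G" for g
    using b_cl[OF g] g cl_D[OF one_closed] DE unfolding b_def by (metis l_one one_closed subsetD)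
  \<comment> \<open>Translating by k sends u_g - u_1 to u_{kg} - u_k, and the cocycle identity
    becomes a telescoping sum.\<close>
  have h_b: "h k (b g) = ae_class N (\<lambda>x. u (k \<otimes>\<^bsub>G\<^esub> g) x - u k x)" if k: "k \<in> carrier G" and g: "g \<in> carrier G" for k g
    using b_cl[OF g] g k h_cl[OF k] unfolding b_def by (metis l_one one_closed)
  have aff: "affine_data_L1 G N E \<pi> b"
    unfolding affine_data_L1_def
  proof (intro conjI ballI \<pi>_hom)
    show "b \<in> carrier G \<rightarrow> E" using b_E by auto
    fix s t assume s: "s \<in> carrier G" and t: "t \<in> carrier G"
    have "Lp_add N (\<pi> s (b t)) (b s) = Lp_add N (ae_class N (\<lambda>x. u (s \<otimes>\<^bsub>G\<^esub> t) x - u s x)) (ae_class N (\<lambda>x. u s x - u \<one>\<^bsub>G\<^esub> x))"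
      using b_E[OF t] h_b[OF s t] by (simp add: \<pi>_def b_def)
    also have "\<dots> = b (s \<otimes>\<^bsub>G\<^esub> t)"
      using s t by (simp add: Lp_add_L1 int b_def)
    finally show "b (s \<otimes>\<^bsub>G\<^esub> t) = Lp_add N (\<pi> s (b t)) (b s)" ..
  qed
  have act: "affine_map_L1 N E \<pi> b g v = Lp_add N (h g v) (b g)" if "v \<in> E" for g v
    using that by (simp add: affine_map_L1_def \<pi>_def)
  have ul: "uniformly_Lipschitz_on G E ?d (affine_map_L1 N E \<pi> b)"
    unfolding uniformly_Lipschitz_on_def
    using K h_lip by (auto intro!: exI[of _ K] simp: act L1_dist_add_right E_L1 hE b_E)
  have pr: "proper_on G E ?d (affine_map_L1 N E \<pi> b)"
    unfolding proper_on_def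
  proof (intro ballI allI impI)
    fix v and R :: real assume v: "v \<in> E"
    \<comment> \<open>The hypothesis \<open>proper\<close> concerns the orbit of 0. Replacing v by 0
      costs K d(v,0) at the image and d(v,0) at the start.\<close>
    define R' where "R' = K * ?d v (Lp_zero N) + ?d v (Lp_zero N) + R"
    show "finite {g \<in> carrier G. ?d (affine_map_L1 N E \<pi> b g v) v \<le> R}"
    proof (rule finite_subset[OF _ proper[of R']], safe)
      fix g assume g: "g \<in> carrier G" and le: "?d (affine_map_L1 N E \<pi> b g v) v \<le> R"
      note inL = E_L1[OF v] E_L1[OF hE[OF g v]] E_L1[OF b_E[OF g]] Lp_zero_in_L1[of N]
      have add0: "Lp_add N (Lp_zero N) (b g) = b g"
        using int[OF g] int[OF one_closed] by (simp add: Lp_zero_def b_def Lp_add_L1)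
      have "(\<integral>x. \<bar>u g x - u \<one>\<^bsub>G\<^esub> x\<bar> \<partial>N) = ?d (b g) (Lp_zero N)"
        using int[OF g] int[OF one_closed] by (simp add: b_def Lp_zero_def L1_dist_ae_class)
      also have "\<dots> \<le> ?d (b g) (Lp_add N (h g v) (b g)) + ?d (Lp_add N (h g v) (b g)) v + ?d v (Lp_zero N)"
        using L1.triangle[OF inL(3) Lp_add_in_L1[OF inL(2,3)] inL(4)] L1.triangle[OF Lp_add_in_L1[OF inL(2,3)] inL(1) inL(4)] by linarith
      also have "?d (b g) (Lp_add N (h g v) (b g)) = ?d (Lp_zero N) (h g v)"
        using L1_dist_add_right[OF inL(4,2,3)] by (simp add: add0)
      also have "\<dots> \<le> K * ?d v (Lp_zero N)"
        using h_lip[OF g v zero_E] h_zero[OF g] L1.commute[of "Lp_zero N" "h g v"] by simp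
      finally show "(\<integral>x. \<bar>u g x - u \<one>\<^bsub>G\<^esub> x\<bar> \<partial>N) \<le> R'" using le by (simp add: R'_def act[OF v])
    qed
  qed
  show ?thesis using E_sub aff ul pr by blast
qed

section \<open>From the orbit kernel to the affine action\<close>

lemma cnd_kernel_sum_nonpos:
  assumes k: "cnd_kernel \<kappa>" and S: "finite S" and z: "(\<Sum>t\<in>S. c t) = 0"
  shows "(\<Sum>s\<in>S. \<Sum>t\<in>S. c s * c t * \<kappa> s t) \<le> 0"
proof -
  obtain h where h: "bij_betw h {..<card S} S"
    using ex_bij_betw_nat_finite[OF S] by (auto simp: atLeast0LessThan)
  have "(\<Sum>i<card S. c (h i)) = 0" using z sum.reindex_bij_betw[OF h, of c] by simp
  from cnd_kernelD[OF k this, of h]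
  have "(\<Sum>i<card S. \<Sum>j<card S. c (h i) * c (h j) * \<kappa> (h i) (h j)) \<le> 0" .
  also have "(\<Sum>i<card S. \<Sum>j<card S. c (h i) * c (h j) * \<kappa> (h i) (h j)) =
    (\<Sum>i<card S. \<Sum>t\<in>S. c (h i) * c t * \<kappa> (h i) t)"
    by (intro sum.cong refl sum.reindex_bij_betw[OF h, of "\<lambda>t. c (h i) * c t * \<kappa> (h i) t" for i])
  also have "\<dots> = (\<Sum>s\<in>S. \<Sum>t\<in>S. c s * c t * \<kappa> s t)"
    by (rule sum.reindex_bij_betw[OF h, of "\<lambda>s. \<Sum>t\<in>S. c s * c t * \<kappa> s t"])
  finally show ?thesis .
qed

lemma affine_action_of_cnd_kernel:
  fixes G :: "('g, 'r) monoid_scheme" and \<kappa> :: "'g \<Rightarrow> 'g \<Rightarrow> real"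
  assumes G: "group G" "countable (carrier G)" and k: "cnd_kernel \<kappa>" and L: "0 \<le> L"
    and quasi: "\<And>g s t. g \<in> carrier G \<Longrightarrow> s \<in> carrier G \<Longrightarrow> t \<in> carrier G \<Longrightarrow>
      \<kappa> (g \<otimes>\<^bsub>G\<^esub> s) (g \<otimes>\<^bsub>G\<^esub> t) \<le> \<kappa> s t + L"
    and proper: "\<And>R. finite {g \<in> carrier G. \<kappa> g \<one>\<^bsub>G\<^esub> \<le> R}"
  shows "\<exists>(N :: (nat \<Rightarrow> real) measure) E \<pi> b. closed_subspace_L1 N E \<and> affine_data_L1 G N E \<pi> b \<and>
     uniformly_Lipschitz_on G E (Lp_dist N 1) (affine_map_L1 N E \<pi> b) \<and>
     proper_on G E (Lp_dist N 1) (affine_map_L1 N E \<pi> b)"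
proof -
  interpret group G by (rule G(1))
  define a where "a = sqrt (2 / pi)"
  have a: "0 < a" by (simp add: a_def)
  define Q where "Q = (\<lambda>g S c. - (\<Sum>s\<in>S. \<Sum>t\<in>S. c s * c t * \<kappa> (g \<otimes>\<^bsub>G\<^esub> s) (g \<otimes>\<^bsub>G\<^esub> t)))"
  obtain N :: "(nat \<Rightarrow> real) measure" and u where
    int: "\<And>t. t \<in> carrier G \<Longrightarrow> integrable N (u t)" and
    norm: "\<And>S c. finite S \<Longrightarrow> S \<subseteq> carrier G \<Longrightarrow> (\<Sum>t\<in>S. c t) = 0 \<Longrightarrow>
      (\<integral>x. \<bar>\<Sum>t\<in>S. c t * u t x\<bar> \<partial>N) =
      a * sqrt (- (\<Sum>s\<in>S. \<Sum>t\<in>S. c s * c t * \<kappa> s t)) + (\<Sum>t\<in>S. \<bar>c t\<bar>)"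
    using cnd_kernel_L1_model[OF k G(2)] unfolding a_def by blast
  \<comment> \<open>The translation is moved from the vectors to the coefficients, which are
    relabelled along g, so that the norm formula applies.\<close>
  have norm_g: "(\<integral>x. \<bar>\<Sum>t\<in>S. c t * u (g \<otimes>\<^bsub>G\<^esub> t) x\<bar> \<partial>N) = a * sqrt (Q g S c) + (\<Sum>t\<in>S. \<bar>c t\<bar>)"
    if S: "finite S" "S \<subseteq> carrier G" and z: "(\<Sum>t\<in>S. c t) = 0" and g: "g \<in> carrier G" for S c g
  proof -
    let ?S = "(\<lambda>t. g \<otimes>\<^bsub>G\<^esub> t) ` S" and ?c = "\<lambda>t. c (inv\<^bsub>G\<^esub> g \<otimes>\<^bsub>G\<^esub> t)"
    have inj: "inj_on (\<lambda>t. g \<otimes>\<^bsub>G\<^esub> t) S" by (rule inj_on_subset[OF inj_on_cmult[OF g] S(2)])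
    have inv: "inv\<^bsub>G\<^esub> g \<otimes>\<^bsub>G\<^esub> (g \<otimes>\<^bsub>G\<^esub> t) = t" if "t \<in> S" for t
      using g S(2) that by (simp add: subset_iff m_assoc[symmetric])
    have re: "(\<Sum>t\<in>?S. F (?c t) t) = (\<Sum>t\<in>S. F (c t) (g \<otimes>\<^bsub>G\<^esub> t))" for F :: "real \<Rightarrow> 'g \<Rightarrow> real"
      by (simp add: sum.reindex[OF inj] inv)
    have "finite ?S" "?S \<subseteq> carrier G" "(\<Sum>t\<in>?S. ?c t) = 0"
      using S g z re[of "\<lambda>c t. c"] by auto
    from norm[OF this] have "(\<integral>x. \<bar>\<Sum>t\<in>?S. ?c t * u t x\<bar> \<partial>N) =
      a * sqrt (- (\<Sum>s\<in>?S. \<Sum>t\<in>?S. ?c s * ?c t * \<kappa> s t)) + (\<Sum>t\<in>?S. \<bar>?c t\<bar>)" .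
    moreover have "(\<Sum>s\<in>?S. \<Sum>t\<in>?S. ?c s * ?c t * \<kappa> s t) =
      (\<Sum>s\<in>?S. \<Sum>t\<in>S. ?c s * c t * \<kappa> s (g \<otimes>\<^bsub>G\<^esub> t))"
      by (intro sum.cong refl re[of "\<lambda>d t. b * d * \<kappa> s t" for b s])
    moreover have "\<dots> = (\<Sum>s\<in>S. \<Sum>t\<in>S. c s * c t * \<kappa> (g \<otimes>\<^bsub>G\<^esub> s) (g \<otimes>\<^bsub>G\<^esub> t))"
      by (rule re[of "\<lambda>d s. \<Sum>t\<in>S. d * c t * \<kappa> s (g \<otimes>\<^bsub>G\<^esub> t)"])
    moreover have "(\<Sum>t\<in>?S. \<bar>?c t\<bar>) = (\<Sum>t\<in>S. \<bar>c t\<bar>)" by (rule re[of "\<lambda>d t. \<bar>d\<bar>"])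
    moreover have "(\<Sum>t\<in>?S. ?c t * u t x) = (\<Sum>t\<in>S. c t * u (g \<otimes>\<^bsub>G\<^esub> t) x)" for x
      by (rule re[of "\<lambda>d t. d * u t x"])
    ultimately show ?thesis by (simp add: Q_def)
  qed
  \<comment> \<open>The upper bound at the inverse of g, applied to the translated points, is the
    missing lower bound.\<close>
  have quasi2: "\<bar>\<kappa> (g \<otimes>\<^bsub>G\<^esub> s) (g \<otimes>\<^bsub>G\<^esub> t) - \<kappa> s t\<bar> \<le> L"
    if "g \<in> carrier G" "s \<in> carrier G" "t \<in> carrier G" for g s t
    using quasi[OF that] quasi[of "inv\<^bsub>G\<^esub> g" "g \<otimes>\<^bsub>G\<^esub> s" "g \<otimes>\<^bsub>G\<^esub> t"] that by (simp add: m_assoc[symmetric])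
  have Q_le: "Q g S c \<le> - (\<Sum>s\<in>S. \<Sum>t\<in>S. c s * c t * \<kappa> s t) + L * (\<Sum>t\<in>S. \<bar>c t\<bar>)\<^sup>2"
    if S: "finite S" "S \<subseteq> carrier G" and g: "g \<in> carrier G" for S c g
  proof -
    have "Q g S c + (\<Sum>s\<in>S. \<Sum>t\<in>S. c s * c t * \<kappa> s t) =
      (\<Sum>s\<in>S. \<Sum>t\<in>S. c s * c t * (\<kappa> s t - \<kappa> (g \<otimes>\<^bsub>G\<^esub> s) (g \<otimes>\<^bsub>G\<^esub> t)))"
      by (simp add: Q_def right_diff_distrib sum_subtractf)
    also have "\<dots> \<le> (\<Sum>s\<in>S. \<Sum>t\<in>S. L * (\<bar>c s\<bar> * \<bar>c t\<bar>))"
    proof (intro sum_mono)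
      fix s t assume "s \<in> S" "t \<in> S"
      then have "\<bar>\<kappa> (g \<otimes>\<^bsub>G\<^esub> s) (g \<otimes>\<^bsub>G\<^esub> t) - \<kappa> s t\<bar> \<le> L" using quasi2[OF g, of s t] S(2) by auto
      then have "\<bar>c s * c t\<bar> * \<bar>\<kappa> s t - \<kappa> (g \<otimes>\<^bsub>G\<^esub> s) (g \<otimes>\<^bsub>G\<^esub> t)\<bar> \<le> \<bar>c s * c t\<bar> * L"
        by (intro mult_left_mono) auto
      moreover have "c s * c t * (\<kappa> s t - \<kappa> (g \<otimes>\<^bsub>G\<^esub> s) (g \<otimes>\<^bsub>G\<^esub> t)) \<le> \<bar>c s * c t\<bar> * \<bar>\<kappa> s t - \<kappa> (g \<otimes>\<^bsub>G\<^esub> s) (g \<otimes>\<^bsub>G\<^esub> t)\<bar>"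
        by (metis abs_ge_self abs_mult)
      ultimately show "c s * c t * (\<kappa> s t - \<kappa> (g \<otimes>\<^bsub>G\<^esub> s) (g \<otimes>\<^bsub>G\<^esub> t)) \<le> L * (\<bar>c s\<bar> * \<bar>c t\<bar>)"
        by (simp add: abs_mult mult_ac)
    qed
    also have "\<dots> = L * (\<Sum>t\<in>S. \<bar>c t\<bar>)\<^sup>2"
      unfolding power2_eq_square sum_product by (simp only: sum_distrib_left)
    finally show ?thesis by simp
  qed
  \<comment> \<open>With q the untranslated form and m the l1 norm, sqrt(q + L m^2) <= sqrt q + sqrt
    L * m. The excess a * sqrt L * m is thus a multiple of the l1 part.\<close>
  define K where "K = 1 + a * sqrt L"
  have K: "1 \<le> K" using a L by (simp add: K_def)
  have "\<exists>E \<pi> b. closed_subspace_L1 N E \<and> affine_data_L1 G N E \<pi> b \<and>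
     uniformly_Lipschitz_on G E (Lp_dist N 1) (affine_map_L1 N E \<pi> b) \<and>
     proper_on G E (Lp_dist N 1) (affine_map_L1 N E \<pi> b)"
  proof (rule affine_action_of_quasi_invariant_L1_norm[OF G(1) int _ K])
    fix S g and c :: "'g \<Rightarrow> real" assume S: "finite S" "S \<subseteq> carrier G" and z: "(\<Sum>t\<in>S. c t) = 0" and g: "g \<in> carrier G"
    define q where "q = - (\<Sum>s\<in>S. \<Sum>t\<in>S. c s * c t * \<kappa> s t)"
    define m where "m = (\<Sum>t\<in>S. \<bar>c t\<bar>)"
    have q: "0 \<le> q" unfolding q_def using cnd_kernel_sum_nonpos[OF k S(1) z] by simp
    have m: "0 \<le> m" unfolding m_def by (rule sum_nonneg) simp
    have "sqrt (Q g S c) \<le> sqrt (q + L * m\<^sup>2)" using Q_le[OF S g, of c] by (simp add: q_def m_def)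
    also have "\<dots> \<le> sqrt q + sqrt (L * m\<^sup>2)" using q L by (intro sqrt_add_le_add_sqrt) auto
    also have "sqrt (L * m\<^sup>2) = sqrt L * m" using m by (simp add: real_sqrt_mult)
    finally have "a * sqrt (Q g S c) + m \<le> a * (sqrt q + sqrt L * m) + m" using a by simp
    also have "\<dots> \<le> K * (a * sqrt q + m)"
      using a L q m by (simp add: K_def algebra_simps)
    finally show "(\<integral>x. \<bar>\<Sum>t\<in>S. c t * u (g \<otimes>\<^bsub>G\<^esub> t) x\<bar> \<partial>N) \<le> K * (\<integral>x. \<bar>\<Sum>t\<in>S. c t * u t x\<bar> \<partial>N)"
      unfolding norm_g[OF S z g] norm[OF S z] q_def m_def .
  next
    fix R
    show "finite {g \<in> carrier G. (\<integral>x. \<bar>u g x - u \<one>\<^bsub>G\<^esub> x\<bar> \<partial>N) \<le> R}"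
    proof (rule finite_subset)
      \<comment> \<open>The identity is set apart because the support {g, 1} has two points only
        otherwise; then the norm is a * sqrt(2 \<kappa>(g,1)) + 2.\<close>
      show "finite (insert \<one>\<^bsub>G\<^esub> {g \<in> carrier G. \<kappa> g \<one>\<^bsub>G\<^esub> \<le> (R / a)\<^sup>2 / 2})" by (rule finite.insertI[OF proper])
      show "{g \<in> carrier G. (\<integral>x. \<bar>u g x - u \<one>\<^bsub>G\<^esub> x\<bar> \<partial>N) \<le> R} \<subseteq> insert \<one>\<^bsub>G\<^esub> {g \<in> carrier G. \<kappa> g \<one>\<^bsub>G\<^esub> \<le> (R / a)\<^sup>2 / 2}"
      proof
        fix g assume "g \<in> {g \<in> carrier G. (\<integral>x. \<bar>u g x - u \<one>\<^bsub>G\<^esub> x\<bar> \<partial>N) \<le> R}"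
        then have g: "g \<in> carrier G" and le: "(\<integral>x. \<bar>u g x - u \<one>\<^bsub>G\<^esub> x\<bar> \<partial>N) \<le> R" by auto
        show "g \<in> insert \<one>\<^bsub>G\<^esub> {g \<in> carrier G. \<kappa> g \<one>\<^bsub>G\<^esub> \<le> (R / a)\<^sup>2 / 2}"
        proof (cases "g = \<one>\<^bsub>G\<^esub>")
          case False
          have "(\<integral>x. \<bar>u g x - u \<one>\<^bsub>G\<^esub> x\<bar> \<partial>N) = a * sqrt (2 * \<kappa> g \<one>\<^bsub>G\<^esub>) + 2"
            using norm[of "{g, \<one>\<^bsub>G\<^esub>}" "\<lambda>t. if t = g then 1 else - 1"] g False
            by (simp add: cnd_kernel_diag[OF k] cnd_kernel_sym[OF k, of "\<one>\<^bsub>G\<^esub>" g])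
          then have "a * sqrt (2 * \<kappa> g \<one>\<^bsub>G\<^esub>) \<le> R" using le by simp
          then have "sqrt (2 * \<kappa> g \<one>\<^bsub>G\<^esub>) \<le> R / a" using a by (simp add: field_simps)
          then have "2 * \<kappa> g \<one>\<^bsub>G\<^esub> \<le> (R / a)\<^sup>2" by (rule sqrt_le_D)
          then show ?thesis using g by simp
        qed simp
      qed
    qed
  qed
  then show ?thesis by blast
qed

lemma integrable_abs_diff_powr:
  fixes f g :: "'a \<Rightarrow> real"
  assumes [measurable]: "f \<in> borel_measurable M" "g \<in> borel_measurable M"
    and int: "integrable M (\<lambda>x. \<bar>f x\<bar> powr p)" "integrable M (\<lambda>x. \<bar>g x\<bar> powr p)" and p: "0 < p"
  shows "integrable M (\<lambda>x. \<bar>f x - g x\<bar> powr p)"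
proof (rule Bochner_Integration.integrable_bound)
  show "integrable M (\<lambda>x. 2 powr p * (\<bar>f x\<bar> powr p + \<bar>g x\<bar> powr p))" using int by simp
  show "AE x in M. norm (\<bar>f x - g x\<bar> powr p) \<le> norm (2 powr p * (\<bar>f x\<bar> powr p + \<bar>g x\<bar> powr p))"
  proof (rule AE_I2)
    fix x
    \<comment> \<open>Bounding by the larger of the two values works for every p > 0, also where the
      triangle inequality for the norm fails.\<close>
    have "\<bar>f x - g x\<bar> powr p \<le> (2 * max \<bar>f x\<bar> \<bar>g x\<bar>) powr p" using p by (intro powr_mono2) auto
    also have "\<dots> = 2 powr p * max \<bar>f x\<bar> \<bar>g x\<bar> powr p" by (simp add: powr_mult)
    also have "\<dots> \<le> 2 powr p * (\<bar>f x\<bar> powr p + \<bar>g x\<bar> powr p)" by (intro mult_left_mono) (auto simp: max_def)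
    finally show "norm (\<bar>f x - g x\<bar> powr p) \<le> norm (2 powr p * (\<bar>f x\<bar> powr p + \<bar>g x\<bar> powr p))" by simp
  qed
qed measurable

text \<open>Both conventions for the metric are powers of the same integral, so p < 1 and p >= 1 can
  be treated together.\<close>

lemma Lp_dist_eq_powr:
  assumes "v \<in> Lp_space M p" "w \<in> Lp_space M p" "0 < p"
  shows "Lp_dist M p v w = (\<integral>x. \<bar>rep v x - rep w x\<bar> powr p \<partial>M) powr (if p \<ge> 1 then 1 / p else 1)"
proof -
  have "Lp_norm M p (Lp_diff M v w) = (\<integral>x. \<bar>rep v x - rep w x\<bar> powr p \<partial>M) powr (1 / p)"
    unfolding Lp_diff_def using rep_Lp(1)[OF assms(1)] rep_Lp(1)[OF assms(2)] by (intro Lp_norm_ae_class) measurable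
  then show ?thesis using assms(3) by (simp add: Lp_dist_def powr_powr)
qed

theorem corollary1p2:
  fixes G :: "('g, 'r) monoid_scheme"
    and M :: "'a measure"
    and p :: real
    and A :: "('a \<Rightarrow> real) set set"
    and \<phi> :: "'g \<Rightarrow> ('a \<Rightarrow> real) set \<Rightarrow> ('a \<Rightarrow> real) set"
  assumes "0 < p" and "p \<le> 2"
    and "group G" and "countable (carrier G)"
    and "A \<subseteq> Lp_space M p" and "A \<noteq> {}"
    and "group_action G A \<phi>"
    and "uniformly_Lipschitz_on G A (Lp_dist M p) \<phi>"
    and "proper_on G A (Lp_dist M p) \<phi>"
  shows "\<exists>(N :: (nat \<Rightarrow> real) measure) E \<pi> b.
           closed_subspace_L1 N E \<and>
           affine_data_L1 G N E \<pi> b \<and>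
           uniformly_Lipschitz_on G E (Lp_dist N 1) (affine_map_L1 N E \<pi> b) \<and>
           proper_on G E (Lp_dist N 1) (affine_map_L1 N E \<pi> b)"
proof -
  interpret group G by (rule assms(3))
  interpret act: group_action G A \<phi> by (rule assms(7))
  obtain x0 where x0: "x0 \<in> A" using assms(6) by blast
  have orb: "\<phi> t x0 \<in> A" if "t \<in> carrier G" for t using act.element_image[OF that x0 refl] .
  have orbL: "\<phi> t x0 \<in> Lp_space M p" if "t \<in> carrier G" for t using orb[OF that] assms(5) by blast
  define q where "q = (if p \<ge> 1 then 1 / p else 1)"
  have q: "0 < q" using assms(1) by (simp add: q_def)
  \<comment> \<open>Kernels live on the whole type, so elements outside the group receive the zero
    function; this keeps measurability, integrability and conditional negativity
    unconditional.\<close>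
  define X where "X = (\<lambda>t. if t \<in> carrier G then rep (\<phi> t x0) else (\<lambda>_. 0))"
  define D where "D = (\<lambda>s t. \<integral>w. \<bar>X s w - X t w\<bar> powr p \<partial>M)"
  have X: "X t \<in> borel_measurable M" "integrable M (\<lambda>w. \<bar>X t w\<bar> powr p)" for t
    using rep_Lp(1,2)[OF orbL] by (auto simp: X_def)
  have D_nn: "0 \<le> D s t" for s t by (simp add: D_def)
  have cndD: "cnd_kernel D"
    unfolding D_def
  proof (rule cnd_kernel_integral)
    show "cnd_kernel (\<lambda>s t. \<bar>X s w - X t w\<bar> powr p)" for w
      by (rule cnd_kernel_abs_powr[OF assms(1,2), of "\<lambda>t. X t w"])
    show "integrable M (\<lambda>w. \<bar>X s w - X t w\<bar> powr p)" for s t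
      by (rule integrable_abs_diff_powr[OF X(1) X(1) X(2) X(2) assms(1)])
  qed
  have dist: "Lp_dist M p (\<phi> s x0) (\<phi> t x0) = D s t powr q" if "s \<in> carrier G" "t \<in> carrier G" for s t
    using Lp_dist_eq_powr[OF orbL[OF that(1)] orbL[OF that(2)] assms(1)] that by (simp add: D_def X_def q_def)
  obtain C where C: "1 \<le> C" "\<And>g v w. g \<in> carrier G \<Longrightarrow> v \<in> A \<Longrightarrow> w \<in> A \<Longrightarrow> Lp_dist M p (\<phi> g v) (\<phi> g w) \<le> C * Lp_dist M p v w"
    using assms(8) unfolding uniformly_Lipschitz_on_def by blast
  \<comment> \<open>The distance is D^q, so the Lipschitz constant C of the action becomes C^(1/q)
    for D.\<close>
  have lip: "D (g \<otimes>\<^bsub>G\<^esub> s) (g \<otimes>\<^bsub>G\<^esub> t) \<le> C powr (1 / q) * D s t"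
    if g: "g \<in> carrier G" and s: "s \<in> carrier G" and t: "t \<in> carrier G" for g s t
  proof -
    have "D (g \<otimes>\<^bsub>G\<^esub> s) (g \<otimes>\<^bsub>G\<^esub> t) powr q \<le> C * D s t powr q"
      using C(2)[OF g orb[OF s] orb[OF t]] g s t
      by (simp add: dist act.composition_rule[OF x0, symmetric])
    then have "(D (g \<otimes>\<^bsub>G\<^esub> s) (g \<otimes>\<^bsub>G\<^esub> t) powr q) powr (1 / q) \<le> (C * D s t powr q) powr (1 / q)"
      using q by (intro powr_mono2) auto
    then show ?thesis using q C(1) D_nn by (simp add: powr_powr powr_mult)
  qed
  obtain L where L: "0 \<le> L" "\<And>l m. 0 \<le> l \<Longrightarrow> 0 \<le> m \<Longrightarrow> m \<le> C powr (1 / q) * l \<Longrightarrow> slow m \<le> slow l + L"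
    using slow_quasi_invariant[of "C powr (1 / q)"] by blast
  show ?thesis
  proof (rule affine_action_of_cnd_kernel[OF assms(3,4) cnd_kernel_slow[OF cndD] L(1)])
    fix g s t assume "g \<in> carrier G" "s \<in> carrier G" "t \<in> carrier G"
    then show "slow (D (g \<otimes>\<^bsub>G\<^esub> s) (g \<otimes>\<^bsub>G\<^esub> t)) \<le> slow (D s t) + L"
      by (intro L(2) D_nn lip)
  next
    fix R
    obtain B where B: "\<And>l. 0 \<le> l \<Longrightarrow> slow l \<le> R \<Longrightarrow> l \<le> B" using slow_unbounded[of R] by blast
    have one: "\<phi> \<one>\<^bsub>G\<^esub> x0 = x0" using act.id_eq_one x0 by (metis restrict_apply')
    \<comment> \<open>Properness is available for positive radii only, and
      \<open>\<bar>B\<bar> powr q\<close> may be 0; adding 1 secures this.\<close>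
    have "0 < \<bar>B\<bar> powr q + 1" by (simp add: add_nonneg_pos)
    then have "finite {s \<in> carrier G. Lp_dist M p (\<phi> s x0) x0 \<le> \<bar>B\<bar> powr q + 1}"
      using assms(9) x0 unfolding proper_on_def by blast
    then show "finite {g \<in> carrier G. slow (D g \<one>\<^bsub>G\<^esub>) \<le> R}"
    proof (rule rev_finite_subset, safe)
      fix g assume g: "g \<in> carrier G" and "slow (D g \<one>\<^bsub>G\<^esub>) \<le> R"
      then have "D g \<one>\<^bsub>G\<^esub> \<le> \<bar>B\<bar>" using B[OF D_nn] abs_ge_self order_trans by blast
      then have "D g \<one>\<^bsub>G\<^esub> powr q \<le> \<bar>B\<bar> powr q" using q D_nn by (intro powr_mono2) auto
      then show "Lp_dist M p (\<phi> g x0) x0 \<le> \<bar>B\<bar> powr q + 1" using dist[OF g one_closed] one by simp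
    qed
  qed
qed

end
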